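(* For every pair $\binom{\alpha}{\beta}$ with $\alpha=(\alpha_1,\dots,\alpha_k)\in\mathbb N^k$ and $\beta=(\beta_1,\dots,\beta_k)\in\mathbb P^k$ ($k\ge 0$), the regularization $\phi\binom{\alpha}{\beta}$ is a well-defined element of $\mathrm{GSym}[t][z^{-1},z]]$. The linear map $$\phi:H\to \mathrm{GSym}[t][z^{-1},z]],\qquad \tbinom{\alpha}{\beta}\mapsto \phi\tbinom{\alpha}{\beta},$$ is an algebra homomorphism, where $H$ carries the quasi-shuffle product. Moreover, if $k\ge1$ and $\alpha_k>0$, then $\phi\binom{\alpha}{\beta}\in \mathrm{GSym}[t][[z]]$.
   Context: $\mathbb P$ denotes the positive and $\mathbb N$ the nonnegative integers. Let $X=\{x_i: i\in\mathbb P\}$ be commuting indeterminates. For $\alpha\in\mathbb N^k$ with $k=0$ or $\alpha_k>0$, and $\beta\in\mathbb N^k$, the Stirling left weak quasisymmetric function is $$\widehat M_{\binom{\alpha}{\beta}}=\sum_{0<i_1<\cdots<i_k} i_1^{\beta_1}\cdots i_k^{\beta_k}\,x_{i_1}^{\alpha_1}\cdots x_{i_k}^{\alpha_k}\in\mathbb Q[[X]].$$ $\mathrm{GSym}$ is the $\mathbb Q$-span of all such $\widehat M_{\binom{\alpha}{\beta}}$; it is a subalgebra of $\mathbb Q[[X]]$. Quasi-shuffle algebra. For an additive semigroup $A$, $\mathrm{QS}(A)$ is the free module with basis all finite sequences of elements of $A$, including the empty sequence $\emptyset$, which is the unit. The product $*$ is defined recursively by $$a*b=(a_1,(a_2,\dots,a_m)*b)+(b_1,a*(b_2,\dots,b_n))+(a_1+b_1,(a_2,\dots,a_m)*(b_2,\dots,b_n))$$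 for $a=(a_1,\dots,a_m)$ and $b=(b_1,\dots,b_n)$. Here $(c,\sum\lambda_u u)$ means $\sum\lambda_u(c,u)$. $H=\mathrm{QS}(\mathbb N\times\mathbb P)$ is taken over $\mathbb Q$. Its basis consists of the matrices $\binom{\alpha}{\beta}=\binom{\alpha_1,\dots,\alpha_k}{\beta_1,\dots,\beta_k}$ with $\alpha\in\mathbb N^k$ and $\beta\in\mathbb P^k$. Columns are added componentwise. Regularization. For such $\binom{\alpha}{\beta}$, real $t\ge0$ and complex $z$ with $\mathrm{Re}(z)<0$, consider $$\phi\tbinom{\alpha}{\beta}(t,z)=\sum_{0<i_1<\cdots<i_k}x_{i_1}^{\alpha_1}\cdots x_{i_k}^{\alpha_k}\,e^{(i_1+t)\beta_1z}\cdots e^{(i_k+t)\beta_kz}.$$ For each monomial in $X$, its coefficient is an absolutely convergent series. It is expanded as a Laurent series in $z$ whose coefficients are polynomials in $t$. The result is then rewritten as a formal object by collecting powers of $z$ and of $t$. The element so obtained is $\phi\binom{\alpha}{\beta}$. *)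

theory Defs
  imports "HOL-Analysis.Analysis" "HOL-Library.Poly_Mapping"
begin

text \<open>Monomials in the variables x_i are finitely supported exponent vectors.
  Variables are indexed by nat; only indices i > 0 (the set P) ever occur.
  An element of Q[[X]] is its coefficient function on monomials.\<close>

type_synonym monom = "nat \<Rightarrow>\<^sub>0 nat"
type_synonym qser = "monom \<Rightarrow> rat"

definition mono_of :: "nat list \<Rightarrow> nat list \<Rightarrow> monom" where
  "mono_of is as = (\<Sum>(i, a) \<leftarrow> zip is as. Poly_Mapping.single i a)"

definition incr_idx :: "nat \<Rightarrow> nat list set" where
  "incr_idx k = {is. length is = k \<and> sorted_wrt (<) is \<and> (\<forall>i \<in> set is. 0 < i)}"

definition Mhat_admissible :: "nat list \<Rightarrow> nat list \<Rightarrow> bool" where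
  "Mhat_admissible \<alpha> \<beta> \<longleftrightarrow> length \<alpha> = length \<beta> \<and> (\<alpha> = [] \<or> last \<alpha> > 0)"

definition Mhat :: "nat list \<Rightarrow> nat list \<Rightarrow> qser" where
  "Mhat \<alpha> \<beta> m = (\<Sum>is \<in> {is \<in> incr_idx (length \<alpha>). mono_of is \<alpha> = m}.
       (\<Prod>(i, b) \<leftarrow> zip is \<beta>. (of_nat i :: rat) ^ b))"

definition GSym :: "qser set" where
  "GSym = {f. \<exists>ps :: (rat \<times> nat list \<times> nat list) list.
             (\<forall>(c, \<alpha>, \<beta>) \<in> set ps. Mhat_admissible \<alpha> \<beta>) \<and>
             f = (\<lambda>m. \<Sum>(c, \<alpha>, \<beta>) \<leftarrow> ps. c * Mhat \<alpha> \<beta> m)}"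

text \<open>An element is given by its coefficients: c n j is the coefficient
  (in Q[[X]]) of z^n t^j.\<close>
type_synonym lser = "int \<Rightarrow> nat \<Rightarrow> qser"

definition in_GSym_t_laurent :: "lser \<Rightarrow> bool" where
  "in_GSym_t_laurent c \<longleftrightarrow>
     (\<forall>n j. c n j \<in> GSym) \<and>
     (\<forall>n. finite {j. c n j \<noteq> (\<lambda>_. 0)}) \<and>
     (\<exists>N. \<forall>n < N. \<forall>j. c n j = (\<lambda>_. 0))"

definition in_GSym_t_power :: "lser \<Rightarrow> bool" where
  "in_GSym_t_power c \<longleftrightarrow> in_GSym_t_laurent c \<and> (\<forall>n < 0. \<forall>j. c n j = (\<lambda>_. 0))"

definition lser_one :: lser where
  "lser_one n j m = (if n = 0 \<and> j = 0 \<and> m = 0 then 1 else 0)"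

definition lser_mult :: "lser \<Rightarrow> lser \<Rightarrow> lser" where
  "lser_mult c d n j m =
     (\<Sum>n1 \<in> {n1. c n1 \<noteq> (\<lambda>_ _. 0) \<and> d (n - n1) \<noteq> (\<lambda>_ _. 0)}. \<Sum>j1 \<le> j.
        \<Sum>(m1, m2) \<in> {(p, q). p + q = m}. c n1 j1 m1 * d (n - n1) (j - j1) m2)"

text \<open>A basis element (alpha over beta) is the list of its columns (alpha_i, beta_i);
  it belongs to H iff every beta_i is positive.\<close>
definition H_basis :: "(nat \<times> nat) list \<Rightarrow> bool" where
  "H_basis w \<longleftrightarrow> (\<forall>(a, b) \<in> set w. 0 < b)"

definition col_add :: "nat \<times> nat \<Rightarrow> nat \<times> nat \<Rightarrow> nat \<times> nat" where
  "col_add x y = (fst x + fst y, snd x + snd y)"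

text \<open>The quasi-shuffle product of two words, as the list of resulting words
  (listed with multiplicity; the product is the formal sum of this list).\<close>
fun qsh :: "(nat \<times> nat) list \<Rightarrow> (nat \<times> nat) list \<Rightarrow> (nat \<times> nat) list list" where
  "qsh [] b = [b]"
| "qsh a [] = [a]"
| "qsh (x # xs) (y # ys) =
     map ((#) x) (qsh xs (y # ys)) @ map ((#) y) (qsh (x # xs) ys) @
     map ((#) (col_add x y)) (qsh xs ys)"

text \<open>Coefficient of the monomial m in phi(w)(t,z), as an (absolutely convergent) series.\<close>
definition reg_terms :: "(nat \<times> nat) list \<Rightarrow> real \<Rightarrow> complex \<Rightarrow> nat list \<Rightarrow> complex" where
  "reg_terms w t z is =
     (\<Prod>(i, b) \<leftarrow> zip is (map snd w). exp (complex_of_real ((real i + t) * real b) * z))"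

definition reg_index :: "(nat \<times> nat) list \<Rightarrow> monom \<Rightarrow> nat list set" where
  "reg_index w m = {is \<in> incr_idx (length w). mono_of is (map fst w) = m}"

definition reg_coeff :: "(nat \<times> nat) list \<Rightarrow> monom \<Rightarrow> real \<Rightarrow> complex \<Rightarrow> complex" where
  "reg_coeff w m t z = infsum (reg_terms w t z) (reg_index w m)"

definition lser_coeff_eval :: "lser \<Rightarrow> int \<Rightarrow> monom \<Rightarrow> real \<Rightarrow> complex" where
  "lser_coeff_eval c n m t =
     (\<Sum>j \<in> {j. c n j \<noteq> (\<lambda>_. 0)}. complex_of_real (of_rat (c n j m) * t ^ j))"

text \<open>c is the Laurent expansion in z (coefficients polynomial in t) of phi(w):
  for every monomial and every t \<ge> 0, the Laurent series converges to the
  coefficient series for all z with Re z < 0 sufficiently close to 0.\<close>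
definition is_regularization :: "(nat \<times> nat) list \<Rightarrow> lser \<Rightarrow> bool" where
  "is_regularization w c \<longleftrightarrow>
     (\<forall>m. \<forall>t \<ge> 0. \<exists>r > 0. \<forall>z. Re z < 0 \<and> norm z < r \<longrightarrow>
        ((\<lambda>n::int. lser_coeff_eval c n m t * z powi n) has_sum reg_coeff w m t z) UNIV)"

definition phi :: "(nat \<times> nat) list \<Rightarrow> lser" where
  "phi w = (THE c. in_GSym_t_laurent c \<and> is_regularization w c)"

definition phi_sum :: "(nat \<times> nat) list list \<Rightarrow> lser" where
  "phi_sum ws = (\<lambda>n j m. \<Sum>w \<leftarrow> ws. phi w n j m)"

end

theory Submission
  imports Defs
begin

text \<open>
  If the last exponent of a word is positive, a fixed monomial admits only finitely many index
  sequences; expanding the exponentials gives a power series in \<open>z\<close> whose coefficients are power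
  sums of linear forms in the indices, hence combinations of the functions \<open>Mhat\<close>. A trailing
  column \<open>(0, b)\<close> is summed out as a geometric series: it contributes a factor
  \<open>exp (B z) / (1 - exp (B z))\<close>, which has a simple pole and rational Laurent coefficients, and
  shifts the weight of the preceding column. Induction on the word gives existence; uniqueness is
  that of Laurent coefficients on a half disc and of polynomials in \<open>t\<close> on the nonnegative reals.
  For the product, truncating all indices at \<open>N\<close> turns the quasi-shuffle relation into a finite
  identity in a polynomial ring; letting \<open>N\<close> tend to infinity gives the relation for the coefficient
  functions, and uniqueness of expansions transfers it to \<open>phi\<close>.
\<close>

section \<open>Laurent expansions on a half disc\<close>

text \<open>The coefficient series converge only for \<open>Re z < 0\<close>, so expansions are
  tested on a left half disc instead of a punctured neighbourhood of 0. The cut-off \<open>N\<close>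
  is a lower bound for the exponents, not the exact order.\<close>

definition half_disc_laurent :: "int \<Rightarrow> (int \<Rightarrow> complex) \<Rightarrow> (complex \<Rightarrow> complex) \<Rightarrow> bool" where
  "half_disc_laurent N a f \<longleftrightarrow> (\<forall>n<N. a n = 0) \<and>
     (\<exists>r>0. \<forall>z. Re z < 0 \<and> norm z < r \<longrightarrow> ((\<lambda>n. a n * z powi n) has_sum f z) UNIV)"

lemma half_disc_laurent_mono: "half_disc_laurent N a f \<Longrightarrow> M \<le> N \<Longrightarrow> half_disc_laurent M a f"
  unfolding half_disc_laurent_def by auto

lemma half_disc_laurent_cong:
  assumes "half_disc_laurent N a f" "\<And>z. Re z < 0 \<Longrightarrow> f z = g z"
  shows "half_disc_laurent N a g"
  using assms unfolding half_disc_laurent_def by auto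

text \<open>Dividing by \<open>z powi N\<close> moves a Laurent series with finite principal part
  into the setting of power series over the naturals.\<close>

lemma has_sum_powi_iff_power_series:
  fixes a :: "int \<Rightarrow> complex"
  assumes "\<forall>n<N. a n = 0" "z \<noteq> 0"
  shows "((\<lambda>n. a n * z powi n) has_sum S) UNIV \<longleftrightarrow>
         ((\<lambda>k. a (N + int k) * z ^ k) has_sum (S * z powi (-N))) UNIV"
proof -
  have "((\<lambda>n. a n * z powi n) has_sum S) UNIV \<longleftrightarrow> ((\<lambda>n. a n * z powi n) has_sum S) {N..}"
    by (rule has_sum_cong_neutral) (use assms in auto)
  also have "\<dots> \<longleftrightarrow> ((\<lambda>n. a n * z powi n * z powi (-N)) has_sum (S * z powi (-N))) {N..}"
    using assms(2) by (subst has_sum_cmult_left_iff) auto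
  also have "\<dots> \<longleftrightarrow> ((\<lambda>k. a (N + int k) * z ^ k) has_sum (S * z powi (-N))) UNIV"
  proof (rule has_sum_reindex_bij_witness[of _ "\<lambda>k. N + int k" "\<lambda>n. nat (n - N)"])
    fix n assume n: "n \<in> {N..}"
    have "z powi n * z powi (-N) = z powi (n - N)"
      using assms(2) by (simp add: power_int_diff power_int_minus field_simps)
    also have "\<dots> = z ^ nat (n - N)"
      using n by (simp add: power_int_def)
    finally show "a (N + int (nat (n - N))) * z ^ nat (n - N) = a n * z powi n * z powi (-N)"
      using n by (simp add: mult.assoc)
  qed auto
  finally show ?thesis .
qed

text \<open>Otherwise divide by the power belonging to the first nonzero coefficient. The quotient
  series tends to that coefficient at 0, yet it vanishes along a sequence in the half disc tending
  to 0.\<close>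

lemma power_series_zero_on_half_disc:
  fixes d :: "nat \<Rightarrow> complex"
  assumes r: "r > 0" and sm: "\<And>z. Re z < 0 \<Longrightarrow> norm z < r \<Longrightarrow> (\<lambda>k. d k * z ^ k) sums 0"
  shows "d k = 0"
proof (rule ccontr)
  assume "d k \<noteq> 0"
  define k0 where "k0 = (LEAST k. d k \<noteq> 0)"
  have k0: "d k0 \<noteq> 0" "\<And>k. k < k0 \<Longrightarrow> d k = 0"
    using LeastI[of "\<lambda>k. d k \<noteq> 0", OF \<open>d k \<noteq> 0\<close>] unfolding k0_def by (auto dest: not_less_Least)
  define e where "e = (\<lambda>k. d (k + k0))"
  have e: "(\<lambda>k. e k * z ^ k) sums 0" if "Re z < 0" "norm z < r" for z
  proof -
    have "(\<lambda>k. d (k + k0) * z ^ (k + k0)) sums (0 - (\<Sum>i<k0. d i * z ^ i))"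
      using sums_split_initial_segment[OF sm[OF that], of k0] by simp
    also have "(0 - (\<Sum>i<k0. d i * z ^ i)) = 0"
      using k0(2) by simp
    finally have "(\<lambda>k. d (k + k0) * z ^ (k + k0) / z ^ k0) sums (0 / z ^ k0)"
      by (rule sums_divide)
    moreover have "z \<noteq> 0" using that by auto
    ultimately show ?thesis by (simp add: e_def power_add)
  qed
  define f where "f = (\<lambda>z. suminf (\<lambda>k. e k * z ^ k))"
  have "(f \<longlongrightarrow> e 0) (at 0)"
  proof (rule powser_limit_0)
    show "r / 2 > 0" using r by simp
    fix x :: complex assume "norm x < r / 2"
    \<comment> \<open>Convergence at the single point \<open>- r / 2\<close> gives convergence on
      the whole open disc of radius \<open>r / 2\<close>, including points outside the left half
      plane.\<close>
    moreover have "summable (\<lambda>k. e k * (- complex_of_real (r / 2)) ^ k)"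
      by (rule sums_summable[OF e]) (use r in auto)
    ultimately have "summable (\<lambda>k. e k * x ^ k)"
      using r by (elim powser_inside) auto
    thus "(\<lambda>k. e k * x ^ k) sums f x" unfolding f_def by (rule summable_sums)
  qed
  \<comment> \<open>The shift by 2 keeps every point of the sequence strictly inside the half
    disc.\<close>
  moreover have "filterlim (\<lambda>n. - complex_of_real (r / (real n + 2))) (at 0) sequentially"
  proof (rule filterlim_atI)
    have "(\<lambda>n. r / real (n + 2)) \<longlonglongrightarrow> 0"
      by (rule LIMSEQ_ignore_initial_segment[OF lim_const_over_n])
    hence "(\<lambda>n. r / (real n + 2)) \<longlonglongrightarrow> 0" by (simp add: add.commute)
    hence "(\<lambda>n. - complex_of_real (r / (real n + 2))) \<longlonglongrightarrow> - complex_of_real 0"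
      by (intro tendsto_intros)
    thus "(\<lambda>n. - complex_of_real (r / (real n + 2))) \<longlonglongrightarrow> 0" by simp
    have "r / (real n + 2) \<noteq> 0" for n using r by auto
    thus "\<forall>\<^sub>F n in sequentially. - complex_of_real (r / (real n + 2)) \<noteq> 0"
      by (simp del: of_real_divide)
  qed
  ultimately have "(\<lambda>n. f (- complex_of_real (r / (real n + 2)))) \<longlonglongrightarrow> e 0"
    by (rule filterlim_compose)
  moreover have "f (- complex_of_real (r / (real n + 2))) = 0" for n
  proof -
    have "r / (real n + 2) < r / 1" using r by (intro divide_strict_left_mono) auto
    moreover have "r / (real n + 2) > 0" using r by auto
    ultimately show ?thesis
      unfolding f_def by (intro sums_unique[symmetric] e) (simp_all del: of_real_divide)
  qed
  ultimately have "e 0 = 0" by (simp add: LIMSEQ_const_iff)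
  thus False using k0(1) by (simp add: e_def)
qed

text \<open>Over a common cut-off \<open>K\<close>, the difference of the two series divided by
  \<open>z powi K\<close> is a power series that sums to 0 on a half disc.\<close>

lemma half_disc_laurent_unique:
  assumes "half_disc_laurent N a f" "half_disc_laurent M b f"
  shows "a = b"
proof -
  define K where "K = min M N"
  have a: "half_disc_laurent K a f" and b: "half_disc_laurent K b f"
    using assms by (auto intro: half_disc_laurent_mono simp: K_def)
  from a obtain r1 where r1: "r1 > 0"
    "\<And>z. Re z < 0 \<and> norm z < r1 \<Longrightarrow> ((\<lambda>n. a n * z powi n) has_sum f z) UNIV"
    and a0: "\<forall>n<K. a n = 0"
    unfolding half_disc_laurent_def by blast
  from b obtain r2 where r2: "r2 > 0"
    "\<And>z. Re z < 0 \<and> norm z < r2 \<Longrightarrow> ((\<lambda>n. b n * z powi n) has_sum f z) UNIV"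
    and b0: "\<forall>n<K. b n = 0"
    unfolding half_disc_laurent_def by blast
  have *: "a (K + int k) - b (K + int k) = 0" for k
  proof (rule power_series_zero_on_half_disc[of "min r1 r2" "\<lambda>k. a (K + int k) - b (K + int k)"])
    fix z assume z: "Re z < 0" "norm z < min r1 r2"
    hence "z \<noteq> 0" by auto
    have "((\<lambda>k. a (K + int k) * z ^ k) has_sum (f z * z powi (-K))) UNIV"
      using has_sum_powi_iff_power_series[OF a0 \<open>z \<noteq> 0\<close>] r1(2)[of z] z by simp
    moreover have "((\<lambda>k. b (K + int k) * z ^ k) has_sum (f z * z powi (-K))) UNIV"
      using has_sum_powi_iff_power_series[OF b0 \<open>z \<noteq> 0\<close>] r2(2)[of z] z by simp
    ultimately have "(\<lambda>k. a (K + int k) * z ^ k - b (K + int k) * z ^ k) sums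
        (f z * z powi (-K) - f z * z powi (-K))"
      by (intro sums_diff has_sum_imp_sums)
    thus "(\<lambda>k. (a (K + int k) - b (K + int k)) * z ^ k) sums 0"
      by (simp add: algebra_simps)
  qed (use r1 r2 in auto)
  show ?thesis
  proof
    fix n show "a n = b n"
      using a0 b0 *[of "nat (n - K)"] by (cases "n < K") auto
  qed
qed

section \<open>Sums and products of expansions\<close>

lemma half_disc_laurent_add:
  assumes "half_disc_laurent N a f" "half_disc_laurent N b g"
  shows "half_disc_laurent N (\<lambda>n. a n + b n) (\<lambda>z. f z + g z)"
proof -
  from assms obtain r1 r2 where r: "r1 > 0" "r2 > 0"
    "\<And>z. Re z < 0 \<and> norm z < r1 \<Longrightarrow> ((\<lambda>n. a n * z powi n) has_sum f z) UNIV"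
    "\<And>z. Re z < 0 \<and> norm z < r2 \<Longrightarrow> ((\<lambda>n. b n * z powi n) has_sum g z) UNIV"
    unfolding half_disc_laurent_def by blast
  have "((\<lambda>n. (a n + b n) * z powi n) has_sum (f z + g z)) UNIV"
    if "Re z < 0 \<and> norm z < min r1 r2" for z
    using has_sum_add[OF r(3)[of z] r(4)[of z]] that by (simp add: distrib_right)
  moreover have "min r1 r2 > 0" using r by simp
  moreover have "\<forall>n<N. a n + b n = 0" using assms unfolding half_disc_laurent_def by simp
  ultimately show ?thesis unfolding half_disc_laurent_def by blast
qed

lemma half_disc_laurent_zero: "half_disc_laurent N (\<lambda>_. 0) (\<lambda>_. 0)"
  unfolding half_disc_laurent_def by (auto intro: exI[of _ 1])

lemma half_disc_laurent_sum:
  assumes "\<And>i. i \<in> I \<Longrightarrow> half_disc_laurent N (a i) (f i)"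
  shows "half_disc_laurent N (\<lambda>n. \<Sum>i\<in>I. a i n) (\<lambda>z. \<Sum>i\<in>I. f i z)"
proof (cases "finite I")
  case True
  thus ?thesis using assms
    by (induction I) (auto intro: half_disc_laurent_add half_disc_laurent_zero)
qed (auto intro: half_disc_laurent_zero)

lemma half_disc_laurent_sum_list:
  assumes "\<And>i. i \<in> set I \<Longrightarrow> \<exists>N. half_disc_laurent N (a i) (f i)"
  shows "\<exists>N. half_disc_laurent N (\<lambda>n. \<Sum>i\<leftarrow>I. a i n) (\<lambda>z. \<Sum>i\<leftarrow>I. f i z)"
  using assms
proof (induction I)
  case (Cons i I)
  obtain N where "half_disc_laurent N (a i) (f i)"
    using Cons.prems by (meson list.set_intros(1))
  moreover obtain M where "half_disc_laurent M (\<lambda>n. \<Sum>i\<leftarrow>I. a i n) (\<lambda>z. \<Sum>i\<leftarrow>I. f i z)"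
    using Cons by (meson list.set_intros(2))
  ultimately have "half_disc_laurent (min N M) (\<lambda>n. a i n + (\<Sum>i\<leftarrow>I. a i n)) (\<lambda>z. f i z + (\<Sum>i\<leftarrow>I. f i z))"
    by (intro half_disc_laurent_add) (auto elim: half_disc_laurent_mono)
  thus ?case by (intro exI[of _ "min N M"]) simp
qed (auto intro: half_disc_laurent_zero)

text \<open>Absolute summability of both factors lets the double series be rearranged by total
  degree. The cut-offs leave only finitely many nonzero terms in each degree.\<close>

lemma half_disc_laurent_mult:
  assumes "half_disc_laurent N a f" "half_disc_laurent M b g"
  shows "half_disc_laurent (N + M) (\<lambda>n. \<Sum>k\<in>{N..n - M}. a k * b (n - k)) (\<lambda>z. f z * g z)"
proof -
  from assms obtain r1 r2 where r: "r1 > 0" "r2 > 0"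
    "\<And>z. Re z < 0 \<and> norm z < r1 \<Longrightarrow> ((\<lambda>n. a n * z powi n) has_sum f z) UNIV"
    "\<And>z. Re z < 0 \<and> norm z < r2 \<Longrightarrow> ((\<lambda>n. b n * z powi n) has_sum g z) UNIV"
    and z0: "\<And>n. n < N \<Longrightarrow> a n = 0" "\<And>n. n < M \<Longrightarrow> b n = 0"
    unfolding half_disc_laurent_def by blast
  have "((\<lambda>n. (\<Sum>k\<in>{N..n - M}. a k * b (n - k)) * z powi n) has_sum (f z * g z)) UNIV"
    if z: "Re z < 0 \<and> norm z < min r1 r2" for z
  proof -
    have nz: "z \<noteq> 0" using z by auto
    have sa: "((\<lambda>n. a n * z powi n) has_sum f z) UNIV" and sb: "((\<lambda>n. b n * z powi n) has_sum g z) UNIV"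
      using r z by auto
    have na: "(\<lambda>n. norm (a n * z powi n)) summable_on UNIV"
      using has_sum_imp_summable[OF sa] by (subst (asm) summable_on_iff_abs_summable_on_complex)
    have "(\<lambda>n. norm (b n * z powi n)) summable_on UNIV"
      using has_sum_imp_summable[OF sb] by (subst (asm) summable_on_iff_abs_summable_on_complex)
    hence nb: "((\<lambda>n. norm (b n * z powi n)) has_sum (\<Sum>\<^sub>\<infinity>y. norm (b y * z powi y))) UNIV"
      by (rule has_sum_infsum)
    have "(\<lambda>p. norm (case p of (x, y) \<Rightarrow> (a x * z powi x) * (b y * z powi y))) summable_on UNIV \<times> UNIV"
    proof (rule summable_on_SigmaI)
      show "((\<lambda>y. norm (case (x, y) of (x, y) \<Rightarrow> (a x * z powi x) * (b y * z powi y))) has_sum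
          norm (a x * z powi x) * (\<Sum>\<^sub>\<infinity>y. norm (b y * z powi y))) UNIV" for x
        using nb by (simp add: norm_mult[of "a x * z powi x"] has_sum_cmult_right)
      show "(\<lambda>x. norm (a x * z powi x) * (\<Sum>\<^sub>\<infinity>y. norm (b y * z powi y))) summable_on UNIV"
        using na by (rule summable_on_cmult_left)
    qed auto
    hence "(\<lambda>(x, y). (a x * z powi x) * (b y * z powi y)) summable_on UNIV \<times> UNIV"
      by (rule abs_summable_summable)
    hence "((\<lambda>(x, y). (a x * z powi x) * (b y * z powi y)) has_sum (f z * g z)) (UNIV \<times> UNIV)"
      by (intro has_sum_SigmaI[where g = "\<lambda>x. a x * z powi x * g z"])
         (auto intro!: has_sum_cmult_right has_sum_cmult_left sa sb)
    also have "?this \<longleftrightarrow> ((\<lambda>(n, k). a k * b (n - k) * z powi n) has_sum (f z * g z)) (UNIV \<times> UNIV)"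
      by (rule has_sum_reindex_bij_witness[of _ "\<lambda>(n, k). (k, n - k)" "\<lambda>(x, y). (x + y, x)"])
         (auto simp: power_int_add nz)
    finally show ?thesis
    proof (rule has_sum_SigmaD)
      fix n :: int
      have "((\<lambda>k. a k * b (n - k) * z powi n) has_sum (\<Sum>k\<in>{N..n - M}. a k * b (n - k) * z powi n)) {N..n - M}"
        by (rule has_sum_finite) auto
      also have "?this \<longleftrightarrow> ((\<lambda>k. a k * b (n - k) * z powi n) has_sum (\<Sum>k\<in>{N..n - M}. a k * b (n - k) * z powi n)) UNIV"
      proof (rule has_sum_cong_neutral)
        fix k assume "k \<in> UNIV - {N..n - M}"
        hence "k < N \<or> n - k < M" by auto
        thus "a k * b (n - k) * z powi n = 0" using z0 by auto
      qed auto
      finally show "((\<lambda>k. case (n, k) of (n, k) \<Rightarrow> a k * b (n - k) * z powi n) has_sum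
          (\<Sum>k\<in>{N..n - M}. a k * b (n - k)) * z powi n) UNIV"
        by (simp add: sum_distrib_right)
    qed
  qed
  moreover have "min r1 r2 > 0" using r by simp
  ultimately show ?thesis unfolding half_disc_laurent_def by (intro conjI exI[of _ "min r1 r2"]) auto
qed

section \<open>Expansions of the exponential and of the geometric factor\<close>

lemma half_disc_laurent_exp:
  "half_disc_laurent 0 (\<lambda>n. if n < 0 then 0 else x ^ nat n / fact (nat n)) (\<lambda>z. exp (x * z))"
  unfolding half_disc_laurent_def
proof (intro conjI exI[of _ "1 :: real"] allI impI)
  fix z :: complex assume "Re z < 0 \<and> cmod z < 1"
  hence "z \<noteq> 0" by auto
  have "(\<lambda>k. (x * z) ^ k /\<^sub>R fact k) sums exp (x * z)"
    by (rule exp_converges)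
  moreover have "summable (\<lambda>k. norm ((x * z) ^ k /\<^sub>R fact k))"
    by (rule summable_norm_exp)
  ultimately have "((\<lambda>k. (x * z) ^ k /\<^sub>R fact k) has_sum exp (x * z)) UNIV"
    by (intro norm_summable_imp_has_sum)
  thus "((\<lambda>n. (if n < 0 then 0 else x ^ nat n / fact (nat n)) * z powi n) has_sum exp (x * z)) UNIV"
    using \<open>z \<noteq> 0\<close> by (subst has_sum_powi_iff_power_series[of 0])
      (simp_all add: power_mult_distrib scaleR_conv_of_real divide_inverse mult_ac)
qed auto

lemma of_rat_fact: "(of_rat (fact n) :: 'a :: field_char_0) = fact n"
  by (metis of_nat_fact of_rat_of_nat_eq)

text \<open>The expansion of \<open>z * exp (B * z) / (1 - exp (B * z))\<close>, a power series since the pole at 0 is simple.\<close>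

definition rat_geom_fps :: "nat \<Rightarrow> rat fps" where
  "rat_geom_fps B = fps_exp (of_nat B) * inverse (fps_shift 1 (1 - fps_exp (of_nat B)))"

text \<open>The series \<open>D\<close> of \<open>(1 - exp (B * z)) / z\<close> has constant term
  \<open>- B\<close>, which is nonzero. So \<open>exp (B * z) / D\<close> has positive radius of
  convergence, and dividing it by \<open>z\<close> yields the simple pole.\<close>

lemma half_disc_laurent_geometric:
  assumes "B > 0"
  shows "half_disc_laurent (-1) (\<lambda>n. if n < -1 then 0 else of_rat (fps_nth (rat_geom_fps B) (nat (n + 1))))
           (\<lambda>z. exp (of_nat B * z) / (1 - exp (of_nat B * z)))"
proof -
  define D where "D = fps_shift 1 (1 - fps_exp (of_nat B :: complex))"
  define Dr where "Dr = fps_shift 1 (1 - fps_exp (of_nat B :: rat))"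
  define G where "G = Abs_fps (\<lambda>n. of_rat (fps_nth (rat_geom_fps B) n) :: complex)"
  have D0: "fps_nth D 0 \<noteq> 0" and Dr0: "fps_nth Dr 0 \<noteq> 0"
    using assms by (auto simp: D_def Dr_def)
  have D_eq: "fps_nth D n = of_rat (fps_nth Dr n)" for n
    by (simp add: D_def Dr_def of_rat_minus of_rat_divide of_rat_power of_rat_fact of_rat_diff del: fact_Suc power_Suc)
  have "rat_geom_fps B * Dr = fps_exp (of_nat B)"
    using Dr0 unfolding rat_geom_fps_def Dr_def[symmetric] by (simp add: mult.assoc inverse_mult_eq_1)
  \<comment> \<open>The equation is obtained over the rationals and carried through
    \<open>of_rat\<close> coefficientwise; this ties the rational coefficients to the complex series
    \<open>G\<close>.\<close>
  hence "of_rat (fps_nth (rat_geom_fps B * Dr) n) = (of_nat B ^ n / fact n :: complex)" for n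
    by (simp add: of_rat_divide of_rat_power of_rat_fact)
  hence GD: "G * D = fps_exp (of_nat B)"
    by (intro fps_ext) (simp add: fps_mult_nth G_def D_eq of_rat_sum of_rat_mult)
  hence G_eq: "G = fps_exp (of_nat B) * inverse D"
    using D0 by (metis inverse_mult_eq_1' mult.assoc mult.right_neutral)
  have radD: "fps_conv_radius D = \<infinity>"
  proof -
    have "min (fps_conv_radius (1 :: complex fps)) (fps_conv_radius (fps_exp (of_nat B :: complex)))
            \<le> fps_conv_radius (1 - fps_exp (of_nat B :: complex))"
      by (rule fps_conv_radius_diff)
    thus ?thesis by (simp add: D_def)
  qed
  have "fps_conv_radius (inverse D) > 0"
    using fps_conv_radius_inverse_pos[OF D0] radD by simp
  moreover have "fps_conv_radius G \<ge> min (fps_conv_radius (fps_exp (of_nat B :: complex))) (fps_conv_radius (inverse D))"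
    unfolding G_eq by (rule fps_conv_radius_mult)
  ultimately have radG: "fps_conv_radius G > 0" by (simp add: min_def)
  then obtain r where r: "r > 0" "ereal r < fps_conv_radius G"
    using ereal_dense2[OF radG] by auto
  show ?thesis
    unfolding half_disc_laurent_def
  proof (intro conjI exI[of _ r] allI impI r)
    fix z :: complex assume z: "Re z < 0 \<and> norm z < r"
    hence nz: "z \<noteq> 0" and zr: "ereal (norm z) < fps_conv_radius G"
      using r by (auto intro: less_trans[of _ "ereal r"])
    \<comment> \<open>The half plane enters here: \<open>B > 0\<close> forces the exponential below
      1 in norm, so the denominator does not vanish.\<close>
    have "norm (exp (of_nat B * z)) < 1" using z assms by (auto simp: mult_pos_neg)
    hence ne: "exp (of_nat B * z) \<noteq> 1" by (metis less_irrefl norm_one)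
    have "eval_fps G z * eval_fps D z = exp (of_nat B * z)"
      using zr radD GD by (simp add: eval_fps_mult[symmetric] eval_fps_exp)
    moreover have "z * eval_fps D z = 1 - exp (of_nat B * z)"
    proof -
      have "fps_X * D = 1 - fps_exp (of_nat B)"
        by (rule fps_ext) (auto simp: D_def)
      hence "eval_fps (fps_X * D) z = eval_fps (1 - fps_exp (of_nat B)) z" by simp
      thus ?thesis using radD by (simp add: eval_fps_mult eval_fps_diff eval_fps_exp)
    qed
    ultimately have "eval_fps G z * (1 - exp (of_nat B * z)) = exp (of_nat B * z) * z"
      by (metis mult.assoc mult.commute)
    hence ev: "eval_fps G z = exp (of_nat B * z) / (1 - exp (of_nat B * z)) * z"
      using ne by (simp add: field_simps)
    have "(\<lambda>n. fps_nth G n * z ^ n) sums eval_fps G z"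
      using zr by (rule sums_eval_fps)
    moreover have "summable (\<lambda>n. norm (fps_nth G n * z ^ n))"
      using zr by (intro abs_summable_in_conv_radius) (auto simp: fps_conv_radius_def)
    ultimately have "((\<lambda>n. fps_nth G n * z ^ n) has_sum
        (exp (of_nat B * z) / (1 - exp (of_nat B * z)) * z)) UNIV"
      unfolding ev by (intro norm_summable_imp_has_sum)
    thus "((\<lambda>n. (if n < -1 then 0 else of_rat (fps_nth (rat_geom_fps B) (nat (n + 1)))) * z powi n)
        has_sum exp (of_nat B * z) / (1 - exp (of_nat B * z))) UNIV"
      using nz by (subst has_sum_powi_iff_power_series[of "-1"]) (simp_all add: G_def)
  qed auto
qed

section \<open>Summing out trailing columns with zero exponent\<close>

lemma GSym_zero: "(\<lambda>_. 0) \<in> GSym"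
  unfolding GSym_def by (auto intro!: exI[of _ "[]"])

lemma GSym_add:
  assumes "f \<in> GSym" "g \<in> GSym"
  shows "(\<lambda>m. f m + g m) \<in> GSym"
proof -
  from assms obtain ps qs where
    "\<forall>(c, \<alpha>, \<beta>) \<in> set ps. Mhat_admissible \<alpha> \<beta>" "f = (\<lambda>m. \<Sum>(c, \<alpha>, \<beta>) \<leftarrow> ps. c * Mhat \<alpha> \<beta> m)"
    "\<forall>(c, \<alpha>, \<beta>) \<in> set qs. Mhat_admissible \<alpha> \<beta>" "g = (\<lambda>m. \<Sum>(c, \<alpha>, \<beta>) \<leftarrow> qs. c * Mhat \<alpha> \<beta> m)"
    unfolding GSym_def by blast
  thus ?thesis unfolding GSym_def by (intro CollectI exI[of _ "ps @ qs"]) auto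
qed

lemma GSym_scale:
  assumes "f \<in> GSym"
  shows "(\<lambda>m. x * f m) \<in> GSym"
proof -
  from assms obtain ps where ps:
    "\<forall>(c, \<alpha>, \<beta>) \<in> set ps. Mhat_admissible \<alpha> \<beta>" "f = (\<lambda>m. \<Sum>(c, \<alpha>, \<beta>) \<leftarrow> ps. c * Mhat \<alpha> \<beta> m)"
    unfolding GSym_def by blast
  have "x * f m = (\<Sum>(c, \<alpha>, \<beta>) \<leftarrow> map (\<lambda>(c, p). (x * c, p)) ps. c * Mhat \<alpha> \<beta> m)" for m
    unfolding ps(2) sum_list_const_mult[symmetric] map_map
    by (intro arg_cong[of _ _ sum_list] map_cong) auto
  thus ?thesis using ps(1)
    unfolding GSym_def by (intro CollectI exI[of _ "map (\<lambda>(c, p). (x * c, p)) ps"]) auto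
qed

lemma GSym_sum:
  assumes "\<And>i. i \<in> I \<Longrightarrow> f i \<in> GSym"
  shows "(\<lambda>m. \<Sum>i\<in>I. f i m) \<in> GSym"
proof (cases "finite I")
  case True
  thus ?thesis using assms by (induction I) (auto intro: GSym_zero GSym_add)
qed (auto intro: GSym_zero)

lemma Mhat_in_GSym: "Mhat_admissible \<alpha> \<beta> \<Longrightarrow> Mhat \<alpha> \<beta> \<in> GSym"
  unfolding GSym_def by (intro CollectI exI[of _ "[(1, \<alpha>, \<beta>)]"]) auto

section \<open>Index sequences with a prescribed monomial\<close>

lemma mono_of_Nil [simp]: "mono_of [] as = 0"
  by (simp add: mono_of_def)

lemma mono_of_snoc:
  "length is = length as \<Longrightarrow> mono_of (is @ [i]) (as @ [a]) = mono_of is as + Poly_Mapping.single i a"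
  by (simp add: mono_of_def)

text \<open>The value 0 for the empty list makes \<open>last0 is < i\<close> express positivity of a
  first index, so appending an index is uniform.\<close>

definition last0 :: "nat list \<Rightarrow> nat" where
  "last0 is = (if is = [] then 0 else last is)"

lemma last0_simps [simp]: "last0 [] = 0" "last0 (is @ [i]) = i"
  by (auto simp: last0_def)

lemma incr_idx_snoc_iff: "is @ [i] \<in> incr_idx (Suc k) \<longleftrightarrow> is \<in> incr_idx k \<and> last0 is < i"
proof (cases "is" rule: rev_cases)
  case (snoc js j)
  show ?thesis unfolding snoc by (auto simp: incr_idx_def sorted_wrt_append)
qed (auto simp: incr_idx_def)

lemma reg_index_Nil: "reg_index [] m = (if m = 0 then {[]} else {})"
  by (auto simp: reg_index_def incr_idx_def)

lemma reg_index_length: "is \<in> reg_index w m \<Longrightarrow> length is = length w"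
  by (simp add: reg_index_def incr_idx_def)

lemma reg_index_snoc_iff:
  "is @ [i] \<in> reg_index (v @ [(a, b)]) m \<longleftrightarrow>
     is \<in> incr_idx (length v) \<and> last0 is < i \<and> mono_of is (map fst v) + Poly_Mapping.single i a = m"
proof -
  have "length is = length v" if "is \<in> incr_idx (length v)" using that by (simp add: incr_idx_def)
  thus ?thesis by (auto simp: reg_index_def incr_idx_snoc_iff mono_of_snoc)
qed

lemma reg_index_snoc_cases:
  assumes "is \<in> reg_index (v @ [x]) m"
  obtains js j where "is = js @ [j]"
proof (cases "is" rule: rev_cases)
  case Nil
  thus ?thesis using reg_index_length[OF assms] by simp
qed (use that in auto)

text \<open>A column with exponent 0 leaves the monomial unchanged, so its index is free above the
  preceding one. This is the source of the infinite sums.\<close>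

lemma reg_index_snoc_zero:
  "reg_index (v @ [(0, b)]) m = (\<lambda>(is, i). is @ [i]) ` (SIGMA is:reg_index v m. {last0 is<..})"
proof -
  have "is @ [i] \<in> reg_index (v @ [(0, b)]) m \<longleftrightarrow> is \<in> reg_index v m \<and> last0 is < i" for "is" i
    unfolding reg_index_snoc_iff by (auto simp: reg_index_def)
  note iff = this
  show ?thesis
  proof (intro equalityI subsetI)
    fix js assume js: "js \<in> reg_index (v @ [(0, b)]) m"
    then obtain "is" i where "js = is @ [i]" by (rule reg_index_snoc_cases)
    with js iff show "js \<in> (\<lambda>(is, i). is @ [i]) ` (SIGMA is:reg_index v m. {last0 is<..})" by auto
  qed (use iff in auto)
qed

text \<open>The last index carries a positive exponent, hence is a variable of \<open>m\<close>, and
  it bounds all earlier indices.\<close>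

lemma finite_reg_index:
  assumes "w = [] \<or> fst (last w) > 0"
  shows "finite (reg_index w m)"
proof (cases w rule: rev_cases)
  case Nil
  thus ?thesis by (simp add: reg_index_Nil)
next
  case (snoc v x)
  obtain a b where x: "x = (a, b)" by force
  with assms snoc have a: "a > 0" by simp
  have "reg_index w m \<subseteq> {is. set is \<subseteq> {..Max (Poly_Mapping.keys m)} \<and> length is = length w}"
  proof
    fix "is" assume "is": "is \<in> reg_index w m"
    then obtain js j where js: "is = js @ [j]" unfolding snoc by (rule reg_index_snoc_cases)
    have "mono_of js (map fst v) + Poly_Mapping.single j a = m"
      using "is" by (simp add: js snoc x reg_index_snoc_iff)
    hence "Poly_Mapping.lookup m j = Poly_Mapping.lookup (mono_of js (map fst v)) j + a"
      by (auto simp: Poly_Mapping.lookup_add)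
    hence "j \<in> Poly_Mapping.keys m" using a by (simp add: in_keys_iff)
    hence "j \<le> Max (Poly_Mapping.keys m)" by (simp add: Max_ge)
    moreover have "\<forall>i\<in>set is. i \<le> j"
      using "is" by (auto simp: js reg_index_def incr_idx_def sorted_wrt_append)
    ultimately show "is \<in> {is. set is \<subseteq> {..Max (Poly_Mapping.keys m)} \<and> length is = length w}"
      using reg_index_length[OF "is"] by fastforce
  qed
  thus ?thesis by (rule finite_subset) (simp add: finite_lists_length_eq)
qed

section \<open>Power sums of linear forms\<close>

lemma prod_list_zip_conv_prod:
  assumes "length xs = k" "length ys = k"
  shows "(\<Prod>(x, y)\<leftarrow>zip xs ys. f x y) = (\<Prod>s<k. f (xs ! s) (ys ! s) :: 'a :: comm_monoid_mult)"
  using assms by (simp add: prod.list_conv_set_nth atLeast0LessThan)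

text \<open>Peel off one linear factor at a time: multiplying by \<open>is ! s\<close> raises the
  entry of \<open>\<gamma>\<close> at position \<open>s\<close> by 1, and \<open>q = 0\<close> is a
  single \<open>Mhat\<close>. Admissibility survives because positivity is asked of the upper row
  only.\<close>

lemma linear_form_power_sum_in_GSym:
  fixes g :: "nat \<Rightarrow> rat"
  assumes w: "w = [] \<or> fst (last w) > 0" and "length \<gamma> = length w"
  shows "(\<lambda>m. \<Sum>is\<in>reg_index w m. (\<Sum>s<length w. g s * of_nat (is ! s)) ^ q *
            (\<Prod>s<length w. of_nat (is ! s) ^ (\<gamma> ! s))) \<in> GSym"
  using assms(2)
proof (induction q arbitrary: \<gamma>)
  case 0
  have "(\<lambda>m. \<Sum>is\<in>reg_index w m. \<Prod>s<length w. of_nat (is ! s) ^ (\<gamma> ! s)) = Mhat (map fst w) \<gamma>"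
    unfolding Mhat_def reg_index_def length_map using 0
    by (intro ext sum.cong refl, subst prod_list_zip_conv_prod[of _ "length w"]) (auto simp: incr_idx_def)
  moreover have "Mhat_admissible (map fst w) \<gamma>"
    using w 0 by (cases "w = []") (auto simp: Mhat_admissible_def last_map)
  ultimately show ?case using Mhat_in_GSym by simp
next
  case (Suc q)
  define k where "k = length w"
  let ?L = "\<lambda>is. \<Sum>s<k. g s * of_nat (is ! s)" and ?M = "\<lambda>\<gamma> is. \<Prod>s<k. of_nat (is ! s) ^ (\<gamma> ! s) :: rat"
  have step: "of_nat (is ! s) * ?M \<gamma> is = ?M (\<gamma>[s := Suc (\<gamma> ! s)]) is" if "s < k" for s "is"
  proof -
    have "?M (\<gamma>[s := Suc (\<gamma> ! s)]) is = (\<Prod>s'<k. (if s' = s then of_nat (is ! s) else 1) * of_nat (is ! s') ^ (\<gamma> ! s'))"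
      using Suc.prems that by (intro prod.cong) (auto simp: k_def nth_list_update)
    also have "\<dots> = of_nat (is ! s) * ?M \<gamma> is"
      using that by (simp add: prod.distrib)
    finally show ?thesis ..
  qed
  have "(\<lambda>m. \<Sum>s<k. g s * (\<Sum>is\<in>reg_index w m. ?L is ^ q * ?M (\<gamma>[s := Suc (\<gamma> ! s)]) is)) \<in> GSym"
    using Suc.prems Suc.IH unfolding k_def by (intro GSym_sum GSym_scale) simp
  also have "(\<lambda>m. \<Sum>s<k. g s * (\<Sum>is\<in>reg_index w m. ?L is ^ q * ?M (\<gamma>[s := Suc (\<gamma> ! s)]) is)) =
      (\<lambda>m. \<Sum>is\<in>reg_index w m. ?L is ^ Suc q * ?M \<gamma> is)"
  proof
    fix m
    have "(\<Sum>s<k. g s * (\<Sum>is\<in>reg_index w m. ?L is ^ q * ?M (\<gamma>[s := Suc (\<gamma> ! s)]) is)) =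
        (\<Sum>s<k. \<Sum>is\<in>reg_index w m. g s * of_nat (is ! s) * (?L is ^ q * ?M \<gamma> is))"
      unfolding sum_distrib_left by (intro sum.cong refl) (simp add: step[symmetric] mult_ac)
    also have "\<dots> = (\<Sum>is\<in>reg_index w m. ?L is * (?L is ^ q * ?M \<gamma> is))"
      by (subst sum.swap) (simp add: sum_distrib_right)
    finally show "(\<Sum>s<k. g s * (\<Sum>is\<in>reg_index w m. ?L is ^ q * ?M (\<gamma>[s := Suc (\<gamma> ! s)]) is)) =
        (\<Sum>is\<in>reg_index w m. ?L is ^ Suc q * ?M \<gamma> is)"
      by (simp add: mult.assoc)
  qed
  finally show ?case unfolding k_def .
qed

section \<open>Iterated summation over trailing indices\<close>

text \<open>
  Summing out a last column \<open>(0, b)\<close> over \<open>i > last0 is\<close> leaves behind the geometric series value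
  \<open>exp ((last0 is + t) * b * z)\<close> times a factor depending on \<open>z\<close> only. The parameter \<open>B\<close> accumulates
  these contributions, which makes the induction on the word go through.
\<close>

definition tail_term :: "(nat \<times> nat) list \<Rightarrow> nat \<Rightarrow> real \<Rightarrow> complex \<Rightarrow> nat list \<Rightarrow> complex" where
  "tail_term w B t z is = reg_terms w t z is * exp (of_real ((real (last0 is) + t) * real B) * z)"

definition tail_sum :: "(nat \<times> nat) list \<Rightarrow> nat \<Rightarrow> monom \<Rightarrow> real \<Rightarrow> complex \<Rightarrow> complex" where
  "tail_sum w B m t z = infsum (tail_term w B t z) (reg_index w m)"

lemma tail_term_0: "tail_term w 0 t z = reg_terms w t z"
  by (auto simp: tail_term_def)

lemma tail_sum_0: "tail_sum w 0 = reg_coeff w"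
  by (intro ext) (simp add: tail_sum_def reg_coeff_def tail_term_0)

lemma tail_term_snoc:
  assumes "length is = length v"
  shows "tail_term (v @ [(a, b)]) B t z (is @ [i]) =
           reg_terms v t z is * exp (of_real ((real i + t) * real (b + B)) * z)"
  using assms by (simp add: tail_term_def reg_terms_def ring_distribs exp_add mult_ac)

text \<open>Writing \<open>i = p + 1 + k\<close> factors out the value at \<open>p\<close>. The
  field is left general: the complex case evaluates the sums, the real case controls their
  norms.\<close>

lemma has_sum_geometric_tail:
  fixes z :: "'a :: {real_normed_field, banach}"
  assumes "norm (exp (of_nat B * z)) < 1"
  shows "((\<lambda>i. exp (of_real ((real i + t) * real B) * z)) has_sum
           (exp (of_real ((real p + t) * real B) * z) * (exp (of_nat B * z) / (1 - exp (of_nat B * z))))) {p<..}"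
proof -
  let ?q = "exp (of_nat B * z)" and ?c = "exp (of_real ((real p + t) * real B) * z)"
  have "((\<lambda>k. ?q ^ k) has_sum (1 / (1 - ?q))) UNIV"
    using assms by (intro norm_summable_imp_has_sum geometric_sums) (auto simp: norm_power summable_geometric)
  hence "((\<lambda>k. ?c * ?q * ?q ^ k) has_sum (?c * ?q * (1 / (1 - ?q)))) UNIV"
    by (rule has_sum_cmult_right)
  moreover have "?c * ?q * ?q ^ k = exp (of_real ((real (p + 1 + k) + t) * real B) * z)" for k
    by (simp add: exp_of_nat_mult[symmetric] exp_add[symmetric] algebra_simps)
  ultimately have "((\<lambda>k. exp (of_real ((real (p + 1 + k) + t) * real B) * z)) has_sum (?c * (?q / (1 - ?q)))) UNIV"
    by simp
  also have "?this \<longleftrightarrow> ?thesis"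
    by (rule has_sum_reindex_bij_witness[of _ "\<lambda>i. i - (p + 1)" "\<lambda>k. p + 1 + k"]) auto
  finally show ?thesis .
qed

lemma inj_on_snoc: "inj_on (\<lambda>(is, i). is @ [i]) A"
  by (auto simp: inj_on_def)

text \<open>Induction from the right with varying \<open>B\<close>. A positive last exponent leaves
  a finite sum; for exponent 0 the inner sum of norms is geometric, and the outer sum is the claim
  for \<open>v\<close> with \<open>b + B\<close>.\<close>

lemma tail_term_summable:
  assumes "H_basis w" "Re z < 0"
  shows "(\<lambda>is. norm (tail_term w B t z is)) summable_on reg_index w m"
  using assms(1)
proof (induction w arbitrary: B rule: rev_induct)
  case Nil
  show ?case by (simp add: finite_reg_index summable_on_finite)
next
  case (snoc x v)
  obtain a b where x: "x = (a, b)" by force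
  have "b > 0" and H: "H_basis v" using snoc.prems by (auto simp: x H_basis_def)
  show ?case
  proof (cases "a = 0")
    case False
    thus ?thesis by (intro summable_on_finite finite_reg_index) (simp add: x)
  next
    case True
    \<comment> \<open>For real \<open>c\<close> the norm of \<open>exp (c * z)\<close> is
      \<open>exp (c * Re z)\<close>, so the norms form a real geometric series with this tail
      factor.\<close>
    let ?E = "exp (real (b + B) * Re z) / (1 - exp (real (b + B) * Re z))"
    have lt: "norm (exp (of_nat (b + B) * Re z)) < 1"
      using \<open>b > 0\<close> assms(2) by (simp add: mult_less_0_iff)
    have "(\<lambda>(is, i). norm (tail_term (v @ [(0, b)]) B t z (is @ [i]))) summable_on
            (SIGMA is:reg_index v m. {last0 is<..})"
    proof (rule summable_on_SigmaI)
      show "(\<lambda>is. norm (tail_term v (b + B) t z is) * ?E) summable_on reg_index v m"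
        by (intro summable_on_cmult_left snoc.IH H)
      fix "is" assume "is \<in> reg_index v m"
      hence "length is = length v" by (rule reg_index_length)
      hence eq1: "norm (tail_term (v @ [(0, b)]) B t z (is @ [i])) =
          norm (reg_terms v t z is) * exp (of_real ((real i + t) * real (b + B)) * Re z)" for i
        by (simp add: tail_term_snoc norm_mult)
      have eq2: "norm (tail_term v (b + B) t z is) * ?E = norm (reg_terms v t z is) *
          (exp (of_real ((real (last0 is) + t) * real (b + B)) * Re z) * ?E)"
        by (simp add: tail_term_def norm_mult)
      show "((\<lambda>i. case (is, i) of (is, i) \<Rightarrow> norm (tail_term (v @ [(0, b)]) B t z (is @ [i]))) has_sum
          norm (tail_term v (b + B) t z is) * ?E) {last0 is<..}"
        unfolding prod.case eq1 eq2 by (intro has_sum_cmult_right has_sum_geometric_tail lt)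
    qed auto
    thus ?thesis unfolding x True reg_index_snoc_zero
      by (subst summable_on_reindex[OF inj_on_snoc]) (simp add: o_def case_prod_unfold)
  qed
qed

text \<open>The absolutely summable family is summed over the last index first. That sum is
  geometric, and its start above \<open>last0 is\<close> becomes the weight \<open>b + B\<close> on
  the shorter word.\<close>

lemma tail_sum_snoc_zero:
  assumes "H_basis (v @ [(0, b)])" "Re z < 0"
  shows "tail_sum (v @ [(0, b)]) B m t z =
           (exp (of_nat (b + B) * z) / (1 - exp (of_nat (b + B) * z))) * tail_sum v (b + B) m t z"
proof -
  let ?E = "exp (of_nat (b + B) * z) / (1 - exp (of_nat (b + B) * z))"
  have "b > 0" and H: "H_basis v" using assms(1) by (auto simp: H_basis_def)
  hence lt: "norm (exp (of_nat (b + B) * z)) < 1"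
    using assms(2) by (simp add: mult_less_0_iff)
  let ?F = "\<lambda>(is, i). tail_term (v @ [(0, b)]) B t z (is @ [i])" and ?S = "SIGMA is:reg_index v m. {last0 is<..}"
  have "tail_term (v @ [(0, b)]) B t z summable_on reg_index (v @ [(0, b)]) m"
    by (rule abs_summable_summable[OF tail_term_summable[OF assms]])
  hence "?F summable_on ?S"
    unfolding reg_index_snoc_zero by (subst (asm) summable_on_reindex[OF inj_on_snoc]) (simp add: o_def case_prod_unfold)
  moreover have "((\<lambda>is. tail_term v (b + B) t z is * ?E) has_sum (tail_sum v (b + B) m t z * ?E)) (reg_index v m)"
    unfolding tail_sum_def
    by (intro has_sum_cmult_left has_sum_infsum abs_summable_summable[OF tail_term_summable[OF H assms(2)]])
  moreover have "((\<lambda>i. ?F (is, i)) has_sum (tail_term v (b + B) t z is * ?E)) {last0 is<..}"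
    if "is \<in> reg_index v m" for "is"
    unfolding prod.case tail_term_snoc[OF reg_index_length[OF that]]
    unfolding tail_term_def mult.assoc[of "reg_terms v t z is"]
    by (intro has_sum_cmult_right has_sum_geometric_tail lt)
  ultimately have "(?F has_sum (tail_sum v (b + B) m t z * ?E)) ?S"
    by (intro has_sum_SigmaI)
  hence "(tail_term (v @ [(0, b)]) B t z has_sum (tail_sum v (b + B) m t z * ?E)) (reg_index (v @ [(0, b)]) m)"
    unfolding reg_index_snoc_zero by (subst has_sum_reindex[OF inj_on_snoc]) (simp add: o_def case_prod_unfold)
  thus ?thesis unfolding tail_sum_def by (simp add: infsumI mult.commute)
qed

section \<open>Existence and uniqueness of the regularization\<close>

text \<open>Polynomials over the complex numbers turn agreement at all real \<open>t \<ge> 0\<close>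
  into a statement about roots. The sum over an infinite support would be 0 by convention, so
  finiteness is assumed where coefficients are read off.\<close>

definition t_poly :: "lser \<Rightarrow> int \<Rightarrow> monom \<Rightarrow> complex poly" where
  "t_poly c n m = (\<Sum>j | c n j \<noteq> (\<lambda>_. 0). Polynomial.monom (of_rat (c n j m)) j)"

lemma lser_coeff_eval_conv_t_poly: "lser_coeff_eval c n m t = poly (t_poly c n m) (of_real t)"
proof -
  have "complex_of_real (of_rat x) = of_rat x" for x
    by (cases x) (simp add: of_rat_rat)
  thus ?thesis unfolding lser_coeff_eval_def t_poly_def by (simp add: poly_sum poly_monom)
qed

lemma coeff_t_poly:
  assumes "finite {j. c n j \<noteq> (\<lambda>_. 0)}"
  shows "coeff (t_poly c n m) j = of_rat (c n j m)"
  using assms by (auto simp: t_poly_def coeff_sum)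

lemma poly_eqI_nonneg_reals:
  fixes p q :: "complex poly"
  assumes "\<And>t. t \<ge> 0 \<Longrightarrow> poly p (of_real t) = poly q (of_real t)"
  shows "p = q"
proof (rule ccontr)
  assume "p \<noteq> q"
  hence "finite {x. poly (p - q) x = 0}" by (intro poly_roots_finite) simp
  moreover have "complex_of_real ` {0..} \<subseteq> {x. poly (p - q) x = 0}" using assms by auto
  ultimately have "finite (complex_of_real ` {0..})" by (rule rev_finite_subset)
  hence "finite {0 :: real..}" by (rule finite_imageD) (auto simp: inj_on_def)
  thus False using infinite_Ici by blast
qed

text \<open>The cut-off comes from \<open>c\<close> alone and serves every \<open>m\<close> and
  \<open>t\<close>; only the radius depends on them.\<close>

lemma is_regularizationD:
  assumes "is_regularization w c" "\<forall>n<N. \<forall>j. c n j = (\<lambda>_. 0)" "t \<ge> 0"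
  shows "half_disc_laurent N (\<lambda>n. poly (t_poly c n m) (of_real t)) (reg_coeff w m t)"
  using assms unfolding half_disc_laurent_def is_regularization_def lser_coeff_eval_conv_t_poly[symmetric]
  by (auto simp: lser_coeff_eval_def)

lemma is_regularizationI:
  assumes "\<And>m t. t \<ge> 0 \<Longrightarrow> \<exists>N. half_disc_laurent N (\<lambda>n. poly (t_poly c n m) (of_real t)) (reg_coeff w m t)"
  shows "is_regularization w c"
  using assms unfolding half_disc_laurent_def is_regularization_def lser_coeff_eval_conv_t_poly by blast

lemma regularization_unique:
  assumes "in_GSym_t_laurent c" "is_regularization w c" "in_GSym_t_laurent d" "is_regularization w d"
  shows "c = d"
proof -
  from assms obtain N M where NM: "\<forall>n<N. \<forall>j. c n j = (\<lambda>_. 0)" "\<forall>n<M. \<forall>j. d n j = (\<lambda>_. 0)"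
    and fin: "\<And>n. finite {j. c n j \<noteq> (\<lambda>_. 0)}" "\<And>n. finite {j. d n j \<noteq> (\<lambda>_. 0)}"
    unfolding in_GSym_t_laurent_def by blast
  have "t_poly c n m = t_poly d n m" for n m
  proof (rule poly_eqI_nonneg_reals)
    fix t :: real assume "t \<ge> 0"
    from half_disc_laurent_unique[OF is_regularizationD[OF assms(2) NM(1) this] is_regularizationD[OF assms(4) NM(2) this]]
    show "poly (t_poly c n m) (of_real t) = poly (t_poly d n m) (of_real t)" by meson
  qed
  hence "(of_rat (c n j m) :: complex) = of_rat (d n j m)" for n j m
    using coeff_t_poly[of c n m j] coeff_t_poly[of d n m j] fin by metis
  thus ?thesis by (intro ext) simp
qed

section \<open>Explicit expansion for a positive last exponent\<close>

text \<open>The exponent of \<open>tail_term w B t z is\<close> is \<open>(tail_form w B is + t * tail_weight w B) * z\<close>.\<close>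

definition tail_form_coeff :: "(nat \<times> nat) list \<Rightarrow> nat \<Rightarrow> nat \<Rightarrow> nat" where
  "tail_form_coeff w B s = snd (w ! s) + (if Suc s = length w then B else 0)"

definition tail_form :: "(nat \<times> nat) list \<Rightarrow> nat \<Rightarrow> nat list \<Rightarrow> nat" where
  "tail_form w B is = (\<Sum>s<length w. tail_form_coeff w B s * is ! s)"

definition tail_weight :: "(nat \<times> nat) list \<Rightarrow> nat \<Rightarrow> nat" where
  "tail_weight w B = (\<Sum>s<length w. snd (w ! s)) + B"

text \<open>All exponentials merge into one. The extra weight \<open>B\<close> multiplies
  \<open>last0 is\<close>, which is the entry at the last position, or 0 for the empty word.\<close>

lemma tail_term_conv_exp:
  assumes "length is = length w"
  shows "tail_term w B t z is = exp (complex_of_real (real (tail_form w B is) + t * real (tail_weight w B)) * z)"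
proof -
  have form: "tail_form w B is = (\<Sum>s<length w. snd (w ! s) * is ! s) + B * last0 is"
  proof (cases "is" rule: rev_cases)
    case Nil
    thus ?thesis using assms by (simp add: tail_form_def)
  next
    case (snoc js j)
    have "tail_form w B is = (\<Sum>s<length w. snd (w ! s) * is ! s) +
        (\<Sum>s<length w. if s = length w - 1 then B * is ! s else 0)"
      unfolding tail_form_def sum.distrib[symmetric] 
      by (intro sum.cong) (auto simp: tail_form_coeff_def algebra_simps)
    also have "(\<Sum>s<length w. if s = length w - 1 then B * is ! s else 0) = B * last0 is"
      using assms[symmetric] snoc by auto
    finally show ?thesis .
  qed
  have "reg_terms w t z is = (\<Prod>s<length w. exp (of_real ((real (is ! s) + t) * real (snd (w ! s))) * z))"
    unfolding reg_terms_def using assms by (subst prod_list_zip_conv_prod[of _ "length w"]) auto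
  also have "\<dots> = exp (of_real (\<Sum>s<length w. (real (is ! s) + t) * real (snd (w ! s))) * z)"
    by (simp add: exp_sum[symmetric] sum_distrib_right)
  finally have "tail_term w B t z is = exp (of_real ((\<Sum>s<length w. (real (is ! s) + t) * real (snd (w ! s)))
      + (real (last0 is) + t) * real B) * z)"
    by (simp only: tail_term_def exp_add[symmetric] distrib_right of_real_add)
  also have "(\<Sum>s<length w. (real (is ! s) + t) * real (snd (w ! s))) + (real (last0 is) + t) * real B =
      real (tail_form w B is) + t * real (tail_weight w B)"
    by (simp add: form tail_weight_def algebra_simps sum.distrib sum_distrib_left)
  finally show ?thesis .
qed

text \<open>This is the coefficient of \<open>z^n t^j\<close> in the sum of
  \<open>exp ((L + t * C) * z)\<close>, with \<open>L\<close> the linear form and \<open>C\<close>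
  the weight. The case \<open>nat n < j\<close> is excluded explicitly because truncated subtraction
  would give \<open>nat n - j = 0\<close>.\<close>

definition tail_ser :: "(nat \<times> nat) list \<Rightarrow> nat \<Rightarrow> lser" where
  "tail_ser w B n j m = (if n < 0 \<or> nat n < j then 0 else
     of_nat (tail_weight w B) ^ j / (fact j * fact (nat n - j)) *
     (\<Sum>is\<in>reg_index w m. of_nat (tail_form w B is) ^ (nat n - j)))"

lemma tail_ser_neg: "n < 0 \<Longrightarrow> tail_ser w B n j = (\<lambda>_. 0)"
  by (simp add: tail_ser_def fun_eq_iff)

lemma tail_ser_support: "{j. tail_ser w B n j \<noteq> (\<lambda>_. 0)} \<subseteq> {..nat n}"
  by (auto simp: tail_ser_def fun_eq_iff)

lemma tail_ser_in_GSym_t_laurent: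
  assumes "w = [] \<or> fst (last w) > 0"
  shows "in_GSym_t_laurent (tail_ser w B)"
  unfolding in_GSym_t_laurent_def
proof (intro conjI allI)
  fix n j
  have "(\<lambda>m. \<Sum>is\<in>reg_index w m. of_nat (tail_form w B is) ^ (nat n - j)) \<in> GSym"
    \<comment> \<open>The zero row makes the additional monomial factor equal to 1.\<close>
    using linear_form_power_sum_in_GSym[OF assms, of "replicate (length w) 0"
        "\<lambda>s. of_nat (tail_form_coeff w B s)" "nat n - j"]
    by (simp add: tail_form_def)
  from GSym_scale[OF this] have "(\<lambda>m. of_nat (tail_weight w B) ^ j / (fact j * fact (nat n - j)) *
     (\<Sum>is\<in>reg_index w m. of_nat (tail_form w B is) ^ (nat n - j))) \<in> GSym" .
  thus "tail_ser w B n j \<in> GSym"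
    unfolding tail_ser_def by (cases "n < 0 \<or> nat n < j") (simp_all only: if_True if_False GSym_zero)
next
  show "finite {j. tail_ser w B n j \<noteq> (\<lambda>_. 0)}" for n
    by (rule finite_subset[OF tail_ser_support]) simp
  show "\<exists>N. \<forall>n<N. \<forall>j. tail_ser w B n j = (\<lambda>_. 0)"
    using tail_ser_neg by blast
qed

lemma half_disc_laurent_tail_ser:
  assumes "w = [] \<or> fst (last w) > 0"
  shows "half_disc_laurent 0 (\<lambda>n. poly (t_poly (tail_ser w B) n m) (of_real t)) (tail_sum w B m t)"
proof -
  let ?x = "\<lambda>is. complex_of_real (real (tail_form w B is) + t * real (tail_weight w B))"
  have "half_disc_laurent 0 (\<lambda>n. \<Sum>is\<in>reg_index w m. if n < 0 then 0 else ?x is ^ nat n / fact (nat n))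
      (\<lambda>z. \<Sum>is\<in>reg_index w m. exp (?x is * z))"
    by (intro half_disc_laurent_sum half_disc_laurent_exp)
  also have "(\<lambda>z. \<Sum>is\<in>reg_index w m. exp (?x is * z)) = tail_sum w B m t"
    unfolding tail_sum_def using finite_reg_index[OF assms]
    by (intro ext) (simp add: tail_term_conv_exp reg_index_length)
  also have "(\<lambda>n. \<Sum>is\<in>reg_index w m. if n < 0 then 0 else ?x is ^ nat n / fact (nat n)) =
      (\<lambda>n. poly (t_poly (tail_ser w B) n m) (of_real t))"
  proof
    fix n
    show "(\<Sum>is\<in>reg_index w m. if n < 0 then 0 else ?x is ^ nat n / fact (nat n)) =
        poly (t_poly (tail_ser w B) n m) (of_real t)"
    proof (cases "n < 0")
      case True
      thus ?thesis by (simp add: t_poly_def tail_ser_neg)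
    next
      case False
      let ?L = "\<lambda>is. complex_of_nat (tail_form w B is)" and ?C = "complex_of_nat (tail_weight w B)"
      have "poly (t_poly (tail_ser w B) n m) (of_real t) =
          (\<Sum>j | tail_ser w B n j \<noteq> (\<lambda>_. 0). of_rat (tail_ser w B n j m) * of_real t ^ j)"
        by (simp add: t_poly_def poly_sum poly_monom)
      \<comment> \<open>Enlarging the support to all \<open>j \<le> nat n\<close> gives the range of
        the binomial theorem.\<close>
      also have "\<dots> = (\<Sum>j\<le>nat n. of_rat (tail_ser w B n j m) * of_real t ^ j)"
        using tail_ser_support[of w B n] by (intro sum.mono_neutral_left) auto
      also have "\<dots> = (\<Sum>j\<le>nat n. \<Sum>is\<in>reg_index w m.
          ?C ^ j / (fact j * fact (nat n - j)) * ?L is ^ (nat n - j) * of_real t ^ j)"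
        using False by (intro sum.cong) (auto simp: tail_ser_def of_rat_mult of_rat_divide of_rat_power
          of_rat_sum of_rat_fact sum_distrib_left sum_distrib_right)
      also have "\<dots> = (\<Sum>is\<in>reg_index w m. \<Sum>j\<le>nat n.
          ?C ^ j / (fact j * fact (nat n - j)) * ?L is ^ (nat n - j) * of_real t ^ j)"
        by (rule sum.swap)
      also have "\<dots> = (\<Sum>is\<in>reg_index w m. ?x is ^ nat n / fact (nat n))"
      proof (rule sum.cong[OF refl])
        fix "is"
        have "?x is ^ nat n = (of_real t * ?C + ?L is) ^ nat n" by (simp add: add.commute)
        also have "\<dots> = (\<Sum>j\<le>nat n. of_nat (nat n choose j) * (of_real t * ?C) ^ j * ?L is ^ (nat n - j))"
          by (rule binomial_ring)
        also have "\<dots> / fact (nat n) = (\<Sum>j\<le>nat n. ?C ^ j / (fact j * fact (nat n - j)) * ?L is ^ (nat n - j) * of_real t ^ j)"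
          unfolding sum_divide_distrib
          by (intro sum.cong) (auto simp: binomial_fact power_mult_distrib)
        finally show "(\<Sum>j\<le>nat n. ?C ^ j / (fact j * fact (nat n - j)) * ?L is ^ (nat n - j) * of_real t ^ j) =
            ?x is ^ nat n / fact (nat n)" ..
      qed
      finally show ?thesis using False by simp
    qed
  qed
  finally show ?thesis .
qed

text \<open>A trailing column \<open>(0, b)\<close> multiplies the expansion for the shorter word,
  taken with weight \<open>b + B\<close>, by the geometric factor; hence the induction needs all
  \<open>B\<close>. All other words have the explicit series.\<close>

lemma tail_sum_expansion_exists:
  assumes "H_basis w"
  shows "\<exists>c. in_GSym_t_laurent c \<and>
    (\<forall>m t. \<exists>N. half_disc_laurent N (\<lambda>n. poly (t_poly c n m) (of_real t)) (tail_sum w B m t))"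
  using assms
proof (induction w arbitrary: B rule: rev_induct)
  case Nil
  show ?case using tail_ser_in_GSym_t_laurent half_disc_laurent_tail_ser by blast
next
  case (snoc x v)
  obtain a b where x: "x = (a, b)" by force
  have b: "b > 0" and H: "H_basis v" using snoc.prems by (auto simp: x H_basis_def)
  show ?case
  proof (cases "a = 0")
    case False
    hence "fst (last (v @ [x])) > 0" by (simp add: x)
    thus ?thesis using tail_ser_in_GSym_t_laurent half_disc_laurent_tail_ser by blast
  next
    case True
    obtain c where c: "in_GSym_t_laurent c" "\<And>m t. \<exists>N. half_disc_laurent N
        (\<lambda>n. poly (t_poly c n m) (of_real t)) (tail_sum v (b + B) m t)"
      using snoc.IH[OF H] by blast
    from c(1) obtain N where N: "\<And>n j. n < N \<Longrightarrow> c n j = (\<lambda>_. 0)"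
      and fin: "\<And>n. finite {j. c n j \<noteq> (\<lambda>_. 0)}" and G: "\<And>n j. c n j \<in> GSym"
      unfolding in_GSym_t_laurent_def by blast
    define g where "g = (\<lambda>n::int. if n < -1 then 0 else fps_nth (rat_geom_fps (b + B)) (nat (n + 1)))"
    \<comment> \<open>Cauchy product of \<open>c\<close> with the geometric factor, whose order is
      at least \<open>-1\<close>. It is a finite rational combination of coefficients of
      \<open>c\<close>, so it stays in \<open>GSym\<close>.\<close>
    define d :: lser where "d = (\<lambda>n j m. \<Sum>k\<in>{-1..n - N}. g k * c (n - k) j m)"
    have "d n j \<in> GSym" for n j
      unfolding d_def by (intro GSym_sum GSym_scale G)
    moreover have fd: "finite {j. d n j \<noteq> (\<lambda>_. 0)}" for n
    proof (rule finite_subset)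
      show "{j. d n j \<noteq> (\<lambda>_. 0)} \<subseteq> (\<Union>k\<in>{-1..n - N}. {j. c (n - k) j \<noteq> (\<lambda>_. 0)})"
      proof
        fix j assume "j \<in> {j. d n j \<noteq> (\<lambda>_. 0)}"
        then obtain m where "(\<Sum>k\<in>{-1..n - N}. g k * c (n - k) j m) \<noteq> 0" by (auto simp: d_def)
        then obtain k where "k \<in> {-1..n - N}" "g k * c (n - k) j m \<noteq> 0" by (rule sum.not_neutral_contains_not_neutral)
        moreover from this have "c (n - k) j \<noteq> (\<lambda>_. 0)" by (auto simp: fun_eq_iff)
        ultimately show "j \<in> (\<Union>k\<in>{-1..n - N}. {j. c (n - k) j \<noteq> (\<lambda>_. 0)})" by blast
      qed
    qed (use fin in auto)
    moreover have "d n j = (\<lambda>_. 0)" if "n < N - 1" for n j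
      using that by (auto simp: d_def)
    ultimately have "in_GSym_t_laurent d"
      unfolding in_GSym_t_laurent_def by blast
    moreover have "half_disc_laurent (-1 + N) (\<lambda>n. poly (t_poly d n m) (of_real t)) (tail_sum (v @ [x]) B m t)" for m t
    proof -
      \<comment> \<open>The cut-off \<open>M\<close> may depend on \<open>m\<close> and
        \<open>t\<close>; it is replaced by the uniform \<open>N\<close>, below which
        \<open>c\<close> vanishes.\<close>
      obtain M where "half_disc_laurent M (\<lambda>n. poly (t_poly c n m) (of_real t)) (tail_sum v (b + B) m t)"
        using c(2) by blast
      hence "half_disc_laurent N (\<lambda>n. poly (t_poly c n m) (of_real t)) (tail_sum v (b + B) m t)"
        unfolding half_disc_laurent_def by (simp add: N t_poly_def)
      moreover have "half_disc_laurent (-1) (\<lambda>n. of_rat (g n))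
           (\<lambda>z. exp (of_nat (b + B) * z) / (1 - exp (of_nat (b + B) * z)))"
        using half_disc_laurent_geometric[of "b + B"] b by (simp add: g_def if_distrib cong: if_cong)
      ultimately have "half_disc_laurent (-1 + N) (\<lambda>n. \<Sum>k\<in>{-1..n - N}. of_rat (g k) * poly (t_poly c (n - k) m) (of_real t))
          (\<lambda>z. exp (of_nat (b + B) * z) / (1 - exp (of_nat (b + B) * z)) * tail_sum v (b + B) m t z)"
        by (intro half_disc_laurent_mult)
      moreover have "t_poly d n m = (\<Sum>k\<in>{-1..n - N}. Polynomial.smult (of_rat (g k)) (t_poly c (n - k) m))" for n
        by (intro poly_eqI) (simp add: coeff_t_poly[OF fd] coeff_t_poly[OF fin] coeff_sum,
          simp add: d_def of_rat_sum of_rat_mult)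
      ultimately have "half_disc_laurent (-1 + N) (\<lambda>n. poly (t_poly d n m) (of_real t))
          (\<lambda>z. exp (of_nat (b + B) * z) / (1 - exp (of_nat (b + B) * z)) * tail_sum v (b + B) m t z)"
        by (simp add: poly_sum)
      thus ?thesis
        by (rule half_disc_laurent_cong)
           (use snoc.prems in \<open>simp add: x True tail_sum_snoc_zero\<close>)
    qed
    ultimately show ?thesis by blast
  qed
qed

section \<open>The map \<open>phi\<close> on basis words\<close>

lemma regularization_exists_unique:
  assumes "H_basis w"
  shows "\<exists>!c. in_GSym_t_laurent c \<and> is_regularization w c"
proof (rule ex_ex1I)
  obtain c where "in_GSym_t_laurent c"
    "\<And>m t. \<exists>N. half_disc_laurent N (\<lambda>n. poly (t_poly c n m) (of_real t)) (reg_coeff w m t)"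
    using tail_sum_expansion_exists[OF assms, of 0] unfolding tail_sum_0 by blast
  thus "\<exists>c. in_GSym_t_laurent c \<and> is_regularization w c"
    using is_regularizationI by blast
qed (use regularization_unique in blast)

lemma phi_regularization:
  assumes "H_basis w"
  shows "in_GSym_t_laurent (phi w)" "is_regularization w (phi w)"
  using theI'[OF regularization_exists_unique[OF assms]] unfolding phi_def by auto

text \<open>Uniqueness identifies \<open>phi w\<close> with the explicit series, which has no
  negative powers of \<open>z\<close>; this yields the assertion on power series.\<close>

lemma phi_eq_tail_ser:
  assumes "H_basis w" "w = [] \<or> fst (last w) > 0"
  shows "phi w = tail_ser w 0"
proof (rule regularization_unique[OF phi_regularization[OF assms(1)] tail_ser_in_GSym_t_laurent[OF assms(2)]])
  show "is_regularization w (tail_ser w 0)"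
    using half_disc_laurent_tail_ser[OF assms(2), of 0] is_regularizationI unfolding tail_sum_0 by blast
qed

lemma phi_Nil: "phi [] = lser_one"
proof -
  have "phi [] = tail_ser [] 0" by (rule phi_eq_tail_ser) (auto simp: H_basis_def)
  also have "\<dots> = lser_one"
    by (intro ext) (auto simp: tail_ser_def lser_one_def reg_index_Nil tail_weight_def tail_form_def power_0_left)
  finally show ?thesis .
qed

section \<open>Quasi-shuffle product\<close>

text \<open>Recursion on the first column matches that of \<open>qsh\<close>, with \<open>p\<close>
  as strict lower bound for the next index. The abstract weight later takes values in a polynomial
  ring.\<close>

fun trunc_sum :: "(nat \<Rightarrow> nat \<times> nat \<Rightarrow> 'r :: comm_semiring_1) \<Rightarrow> nat \<Rightarrow> (nat \<times> nat) list \<Rightarrow> nat \<Rightarrow> 'r" where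
  "trunc_sum W N [] p = 1"
| "trunc_sum W N (x # xs) p = (\<Sum>i\<in>{p<..N}. W i x * trunc_sum W N xs i)"

text \<open>Split the pairs by \<open>i < j\<close>, \<open>j < i\<close> and \<open>i = j\<close>;
  these become the three terms of the quasi-shuffle recursion.\<close>

lemma sum_times_sum_split:
  fixes A B :: "nat \<Rightarrow> 'r :: comm_semiring_1"
  shows "(\<Sum>i\<in>{p<..N}. A i) * (\<Sum>j\<in>{p<..N}. B j) =
    (\<Sum>i\<in>{p<..N}. A i * (\<Sum>j\<in>{i<..N}. B j)) + (\<Sum>j\<in>{p<..N}. B j * (\<Sum>i\<in>{j<..N}. A i)) +
    (\<Sum>i\<in>{p<..N}. A i * B i)"
proof -
  have "(\<Sum>j\<in>{p<..N}. B j) = (\<Sum>j\<in>{i<..N}. B j) + (\<Sum>j\<in>{j\<in>{p<..N}. j < i}. B j) + B i" if "i \<in> {p<..N}" for i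
  proof -
    have "(\<Sum>j\<in>{p<..N}. B j) = (\<Sum>j\<in>{i<..N} \<union> {j\<in>{p<..N}. j < i} \<union> {i}. B j)"
      using that by (intro sum.cong) auto
    also have "\<dots> = (\<Sum>j\<in>{i<..N} \<union> {j\<in>{p<..N}. j < i}. B j) + B i"
      by (subst sum.union_disjoint) auto
    also have "(\<Sum>j\<in>{i<..N} \<union> {j\<in>{p<..N}. j < i}. B j) = (\<Sum>j\<in>{i<..N}. B j) + (\<Sum>j\<in>{j\<in>{p<..N}. j < i}. B j)"
      by (rule sum.union_disjoint) auto
    finally show ?thesis .
  qed
  hence "(\<Sum>i\<in>{p<..N}. A i) * (\<Sum>j\<in>{p<..N}. B j) =
      (\<Sum>i\<in>{p<..N}. A i * ((\<Sum>j\<in>{i<..N}. B j) + (\<Sum>j\<in>{j\<in>{p<..N}. j < i}. B j) + B i))"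
    unfolding sum_distrib_right by (intro sum.cong) auto
  also have "\<dots> = (\<Sum>i\<in>{p<..N}. A i * (\<Sum>j\<in>{i<..N}. B j)) +
      (\<Sum>i\<in>{p<..N}. \<Sum>j\<in>{j\<in>{p<..N}. j < i}. A i * B j) + (\<Sum>i\<in>{p<..N}. A i * B i)"
    by (simp add: distrib_left sum.distrib sum_distrib_left)
  also have "(\<Sum>i\<in>{p<..N}. \<Sum>j\<in>{j\<in>{p<..N}. j < i}. A i * B j) = (\<Sum>j\<in>{p<..N}. \<Sum>i\<in>{i\<in>{p<..N}. j < i}. A i * B j)"
    by (rule sum.swap_restrict) auto
  also have "\<dots> = (\<Sum>j\<in>{p<..N}. B j * (\<Sum>i\<in>{j<..N}. A i))"
    unfolding sum_distrib_left by (intro sum.cong) (auto simp: mult.commute)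
  finally show ?thesis .
qed

text \<open>Since \<open>W\<close> turns column addition into multiplication, the diagonal pairs
  form a truncated sum with first column \<open>col_add x y\<close>. The bound \<open>p\<close>
  varies because each first index bounds what follows.\<close>

lemma trunc_sum_quasi_shuffle:
  assumes W: "\<And>i x y. W i (col_add x y) = W i x * W i y"
  shows "trunc_sum W N a p * trunc_sum W N b p = (\<Sum>w\<leftarrow>qsh a b. trunc_sum W N w p)"
proof (induction a b arbitrary: p rule: qsh.induct)
  case (3 x xs y ys)
  have Cons: "(\<Sum>w\<leftarrow>map ((#) u) ws. trunc_sum W N w p) =
      (\<Sum>i\<in>{p<..N}. W i u * (\<Sum>w\<leftarrow>ws. trunc_sum W N w i))" for u ws
    by (induction ws) (simp_all add: sum.distrib distrib_left)
  have "trunc_sum W N (x # xs) p * trunc_sum W N (y # ys) p =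
      (\<Sum>i\<in>{p<..N}. W i x * (trunc_sum W N xs i * trunc_sum W N (y # ys) i)) +
      (\<Sum>i\<in>{p<..N}. W i y * (trunc_sum W N (x # xs) i * trunc_sum W N ys i)) +
      (\<Sum>i\<in>{p<..N}. W i (col_add x y) * (trunc_sum W N xs i * trunc_sum W N ys i))"
    by (simp add: sum_times_sum_split W mult_ac)
  also have "\<dots> = (\<Sum>w\<leftarrow>qsh (x # xs) (y # ys). trunc_sum W N w p)"
    unfolding 3 Cons[symmetric] by (simp add: add.assoc)
  finally show ?case .
qed auto

section \<open>Truncated regularizations in a polynomial ring\<close>

definition trunc_idx :: "nat \<Rightarrow> nat \<Rightarrow> nat \<Rightarrow> nat list set" where
  "trunc_idx p N k = {is. length is = k \<and> sorted_wrt (<) is \<and> set is \<subseteq> {p<..N}}"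

lemma finite_trunc_idx: "finite (trunc_idx p N k)"
  by (rule finite_subset[OF _ finite_lists_length_eq[of "{p<..N}" k]]) (auto simp: trunc_idx_def)

lemma trunc_idx_0: "trunc_idx p N 0 = {[]}"
  by (auto simp: trunc_idx_def)

lemma trunc_idx_Suc:
  "trunc_idx p N (Suc k) = (\<lambda>(i, is). i # is) ` (SIGMA i:{p<..N}. trunc_idx i N k)"
proof -
  have iff: "i # is \<in> trunc_idx p N (Suc k) \<longleftrightarrow> i \<in> {p<..N} \<and> is \<in> trunc_idx i N k" for i "is"
    by (auto simp: trunc_idx_def subset_iff)
  show ?thesis
  proof (intro equalityI subsetI)
    fix xs assume xs: "xs \<in> trunc_idx p N (Suc k)"
    then obtain i "is" where "xs = i # is" by (cases xs) (simp_all add: trunc_idx_def)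
    with xs iff show "xs \<in> (\<lambda>(i, is). i # is) ` (SIGMA i:{p<..N}. trunc_idx i N k)" by auto
  qed (use iff in auto)
qed

text \<open>Finitely supported maps from monomials to complex numbers are the polynomials in the
  variables. The weight is a power of the variable with index \<open>i\<close> times the exponential
  at that index.\<close>

definition reg_weight :: "real \<Rightarrow> complex \<Rightarrow> nat \<Rightarrow> nat \<times> nat \<Rightarrow> monom \<Rightarrow>\<^sub>0 complex" where
  "reg_weight t z i x = Poly_Mapping.single (Poly_Mapping.single i (fst x))
     (exp (complex_of_real ((real i + t) * real (snd x)) * z))"

lemma reg_weight_col_add: "reg_weight t z i (col_add x y) = reg_weight t z i x * reg_weight t z i y"
  by (simp add: reg_weight_def col_add_def mult_single single_add distrib_left distrib_right exp_add)

lemma trunc_sum_reg_weight: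
  "trunc_sum (reg_weight t z) N w p = (\<Sum>is\<in>trunc_idx p N (length w).
     Poly_Mapping.single (mono_of is (map fst w)) (reg_terms w t z is))"
proof (induction w arbitrary: p)
  case Nil
  show ?case by (simp add: trunc_idx_0 reg_terms_def)
next
  case (Cons x w)
  have "inj_on (\<lambda>(i, is). i # is) A" for A :: "(nat \<times> nat list) set"
    by (auto simp: inj_on_def)
  note inj = this
  let ?F = "\<lambda>is. Poly_Mapping.single (mono_of is (map fst (x # w))) (reg_terms (x # w) t z is)"
  have "trunc_sum (reg_weight t z) N (x # w) p = (\<Sum>i\<in>{p<..N}. \<Sum>is\<in>trunc_idx i N (length w). ?F (i # is))"
    unfolding trunc_sum.simps Cons.IH sum_distrib_left
    by (intro sum.cong refl) (simp add: reg_weight_def mult_single mono_of_def reg_terms_def)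
  also have "\<dots> = (\<Sum>(i, is)\<in>(SIGMA i:{p<..N}. trunc_idx i N (length w)). ?F (i # is))"
    by (rule sum.Sigma) (auto simp: finite_trunc_idx)
  also have "\<dots> = (\<Sum>is\<in>trunc_idx p N (length (x # w)). ?F is)"
    unfolding length_Cons trunc_idx_Suc by (subst sum.reindex[OF inj]) (simp add: case_prod_unfold)
  finally show ?case .
qed

definition trunc_reg :: "(nat \<times> nat) list \<Rightarrow> monom \<Rightarrow> real \<Rightarrow> complex \<Rightarrow> nat \<Rightarrow> complex" where
  "trunc_reg w m t z N = (\<Sum>is\<in>trunc_idx 0 N (length w). if mono_of is (map fst w) = m then reg_terms w t z is else 0)"

lemma lookup_sum_when:
  "Poly_Mapping.lookup (\<Sum>i\<in>I. Poly_Mapping.single (k i) (f i)) m = (\<Sum>i\<in>I. if k i = m then f i else 0)"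
  by (simp add: Poly_Mapping.lookup_sum lookup_single when_def)

lemma finite_add_decompositions: "finite {(p, q). p + q = (m :: monom)}"
proof (rule finite_subset)
  define D where "D = {p. \<forall>k. Poly_Mapping.lookup p k \<le> Poly_Mapping.lookup m k}"
  show "{(p, q). p + q = m} \<subseteq> D \<times> D"
    by (auto simp: D_def Poly_Mapping.lookup_add)
  have "finite (Poly_Mapping.lookup ` D)"
  proof (rule finite_subset)
    let ?M = "Max (Poly_Mapping.lookup m ` Poly_Mapping.keys m)"
    show "Poly_Mapping.lookup ` D \<subseteq> {f. \<forall>x. (x \<in> Poly_Mapping.keys m \<longrightarrow> f x \<in> {..?M}) \<and>
        (x \<notin> Poly_Mapping.keys m \<longrightarrow> f x = 0)}"
    proof clarify
      fix p x assume p: "p \<in> D"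
      hence le: "Poly_Mapping.lookup p x \<le> Poly_Mapping.lookup m x" by (auto simp: D_def)
      have "Poly_Mapping.lookup p x \<le> ?M" if "x \<in> Poly_Mapping.keys m"
        by (rule order_trans[OF le]) (use that in \<open>intro Max_ge; auto\<close>)
      moreover have "Poly_Mapping.lookup p x = 0" if "x \<notin> Poly_Mapping.keys m"
        using that le by (simp add: in_keys_iff)
      ultimately show "(x \<in> Poly_Mapping.keys m \<longrightarrow> Poly_Mapping.lookup p x \<in> {..?M}) \<and>
          (x \<notin> Poly_Mapping.keys m \<longrightarrow> Poly_Mapping.lookup p x = 0)"
        by blast
    qed
    show "finite {f. \<forall>x. (x \<in> Poly_Mapping.keys m \<longrightarrow> f x \<in> {..?M}) \<and> (x \<notin> Poly_Mapping.keys m \<longrightarrow> f x = 0)}"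
      by (rule finite_set_of_finite_funs) auto
  qed
  hence "finite D" by (rule finite_imageD) (auto simp: inj_on_def lookup_inject)
  thus "finite (D \<times> D)" by simp
qed

text \<open>Compare coefficients of \<open>m\<close> in the quasi-shuffle identity of the polynomial
  ring; convolution over \<open>p + q = m\<close> is multiplication there.\<close>

lemma trunc_reg_mult:
  "(\<Sum>(p, q)\<in>{(p, q). p + q = m}. trunc_reg a p t z N * trunc_reg b q t z N) =
     (\<Sum>w\<leftarrow>qsh a b. trunc_reg w m t z N)"
proof -
  define S where "S = {(p, q). p + q = m}"
  have "finite S" unfolding S_def by (rule finite_add_decompositions)
  let ?T = "\<lambda>w. trunc_sum (reg_weight t z) N w 0" and ?I = "\<lambda>w. trunc_idx 0 N (length w)"
    and ?m = "\<lambda>w is. mono_of is (map fst w)" and ?r = "\<lambda>w is. reg_terms w t z is"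
  have lk: "Poly_Mapping.lookup (?T w) m = trunc_reg w m t z N" for w
    by (simp only: trunc_sum_reg_weight lookup_sum_when trunc_reg_def)
  have "(\<Sum>(p, q)\<in>S. trunc_reg a p t z N * trunc_reg b q t z N) =
      (\<Sum>(p, q)\<in>S. \<Sum>(is, js)\<in>?I a \<times> ?I b. if (?m a is, ?m b js) = (p, q) then ?r a is * ?r b js else 0)"
    unfolding trunc_reg_def sum_product sum.cartesian_product
    by (intro sum.cong refl) (auto intro!: sum.cong)
  also have "\<dots> = (\<Sum>(is, js)\<in>?I a \<times> ?I b. \<Sum>pq\<in>S. if (?m a is, ?m b js) = pq then ?r a is * ?r b js else 0)"
    unfolding case_prod_unfold by (subst sum.swap) simp
  \<comment> \<open>A pair of index lists determines its pair of monomials, so the inner sum keeps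
    the term exactly when that pair lies in \<open>S\<close>.\<close>
  also have "\<dots> = (\<Sum>(is, js)\<in>?I a \<times> ?I b. if ?m a is + ?m b js = m then ?r a is * ?r b js else 0)"
    using \<open>finite S\<close> by (intro sum.cong refl) (auto simp: sum.delta S_def)
  also have "\<dots> = Poly_Mapping.lookup (?T a * ?T b) m"
    unfolding trunc_sum_reg_weight sum_product sum.cartesian_product mult_single
    by (simp add: Poly_Mapping.lookup_sum lookup_single when_def case_prod_unfold)
  also have "\<dots> = Poly_Mapping.lookup (\<Sum>w\<leftarrow>qsh a b. ?T w) m"
    by (simp only: trunc_sum_quasi_shuffle[of "reg_weight t z", OF reg_weight_col_add])
  also have "\<dots> = (\<Sum>w\<leftarrow>qsh a b. Poly_Mapping.lookup (?T w) m)"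
  proof -
    have "Poly_Mapping.lookup (\<Sum>w\<leftarrow>ws. ?T w) m = (\<Sum>w\<leftarrow>ws. Poly_Mapping.lookup (?T w) m)" for ws
      by (induction ws) (simp_all add: Poly_Mapping.lookup_add)
    thus ?thesis .
  qed
  finally show ?thesis unfolding lk S_def .
qed

section \<open>Passage from truncations to full series\<close>

lemma trunc_reg_tendsto:
  assumes "H_basis w" "Re z < 0"
  shows "trunc_reg w m t z \<longlonglongrightarrow> reg_coeff w m t z"
proof -
  \<comment> \<open>The finite sets \<open>A N\<close> lie in \<open>reg_index w m\<close> and
    eventually contain any given finite part of it, so summability gives convergence along
    them.\<close>
  define A where "A = (\<lambda>N. {is \<in> trunc_idx 0 N (length w). mono_of is (map fst w) = m})"
  have "trunc_reg w m t z = (\<lambda>N. sum (reg_terms w t z) (A N))"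
    unfolding trunc_reg_def A_def by (intro ext, subst sum.inter_filter[OF finite_trunc_idx]) simp
  moreover have "(\<lambda>N. sum (reg_terms w t z) (A N)) \<longlonglongrightarrow> reg_coeff w m t z"
  proof (rule filterlim_compose[where g = "sum (reg_terms w t z)" and f = A])
    have "reg_terms w t z summable_on reg_index w m"
      using abs_summable_summable[OF tail_term_summable[OF assms, of 0]] by (simp add: tail_term_0)
    thus "(sum (reg_terms w t z) \<longlongrightarrow> reg_coeff w m t z) (finite_subsets_at_top (reg_index w m))"
      unfolding reg_coeff_def by (rule infsum_tendsto)
    show "filterlim A (finite_subsets_at_top (reg_index w m)) sequentially"
      unfolding filterlim_finite_subsets_at_top
    proof (intro allI impI)
      fix X assume X: "finite X \<and> X \<subseteq> reg_index w m"
      hence "finite (\<Union> (set ` X))" by auto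
      then obtain M where M: "\<Union> (set ` X) \<subseteq> {..M}" by (auto simp: finite_nat_iff_bounded_le)
      show "\<forall>\<^sub>F N in sequentially. finite (A N) \<and> X \<subseteq> A N \<and> A N \<subseteq> reg_index w m"
        using eventually_ge_at_top[of M]
      proof eventually_elim
        case (elim N)
        have "X \<subseteq> A N"
        proof
          fix "is" assume "is": "is \<in> X"
          hence "set is \<subseteq> {..M}" using M by auto
          moreover have "is \<in> reg_index w m" using X "is" by auto
          ultimately show "is \<in> A N" using elim
            by (fastforce simp: A_def trunc_idx_def reg_index_def incr_idx_def)
        qed
        moreover have "A N \<subseteq> reg_index w m"
          by (auto simp: A_def trunc_idx_def reg_index_def incr_idx_def)
        ultimately show ?case by (simp add: A_def finite_trunc_idx)
      qed
    qed
  qed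
  ultimately show ?thesis by simp
qed

lemma H_basis_Cons: "H_basis (x # w) \<longleftrightarrow> 0 < snd x \<and> H_basis w"
  by (auto simp: H_basis_def)

text \<open>Positivity of the lower entries survives column addition, so every word of a product
  again has a regularization.\<close>

lemma H_basis_qsh: "H_basis a \<Longrightarrow> H_basis b \<Longrightarrow> w \<in> set (qsh a b) \<Longrightarrow> H_basis w"
proof (induction a b arbitrary: w rule: qsh.induct)
  case (3 x xs y ys)
  from 3(4,5) have H: "0 < snd x" "H_basis xs" "0 < snd y" "H_basis ys" by (simp_all only: H_basis_Cons)
  from 3(6) consider u where "w = x # u" "u \<in> set (qsh xs (y # ys))"
    | u where "w = y # u" "u \<in> set (qsh (x # xs) ys)"
    | u where "w = col_add x y # u" "u \<in> set (qsh xs ys)"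
    by auto
  thus ?case
  proof cases
    case 1
    with H 3(1)[OF H(2) 3(5)] show ?thesis by (simp only: H_basis_Cons)
  next
    case 2
    with H 3(2)[OF 3(4) H(4)] show ?thesis by (simp only: H_basis_Cons)
  next
    case 3
    with H "3.IH"(3)[OF H(2,4)] show ?thesis by (simp add: H_basis_Cons col_add_def)
  qed
qed auto

text \<open>For fixed \<open>m\<close> both sides are finite sums, so the truncated identity passes
  to the limit term by term.\<close>

lemma reg_coeff_mult:
  assumes "H_basis a" "H_basis b" "Re z < 0"
  shows "(\<Sum>(p, q)\<in>{(p, q). p + q = m}. reg_coeff a p t z * reg_coeff b q t z) =
     (\<Sum>w\<leftarrow>qsh a b. reg_coeff w m t z)"
proof (rule LIMSEQ_unique)
  show "(\<lambda>N. \<Sum>(p, q)\<in>{(p, q). p + q = m}. trunc_reg a p t z N * trunc_reg b q t z N) \<longlonglongrightarrow>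
      (\<Sum>(p, q)\<in>{(p, q). p + q = m}. reg_coeff a p t z * reg_coeff b q t z)"
    unfolding case_prod_unfold by (intro tendsto_sum tendsto_mult trunc_reg_tendsto assms)
  have "(\<lambda>N. \<Sum>w\<leftarrow>ws. trunc_reg w m t z N) \<longlonglongrightarrow> (\<Sum>w\<leftarrow>ws. reg_coeff w m t z)"
    if "\<And>w. w \<in> set ws \<Longrightarrow> H_basis w" for ws
    using that by (induction ws) (auto intro!: tendsto_add trunc_reg_tendsto assms)
  thus "(\<lambda>N. \<Sum>(p, q)\<in>{(p, q). p + q = m}. trunc_reg a p t z N * trunc_reg b q t z N) \<longlonglongrightarrow>
      (\<Sum>w\<leftarrow>qsh a b. reg_coeff w m t z)"
    unfolding trunc_reg_mult using H_basis_qsh[OF assms(1,2)] by blast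
qed

text \<open>For fixed \<open>m\<close> and \<open>t\<close> both sides expand the same function by
  \<open>reg_coeff_mult\<close>; uniqueness in \<open>z\<close>, then in \<open>t\<close>, compares
  coefficients.\<close>

lemma phi_quasi_shuffle:
  assumes a: "H_basis a" and b: "H_basis b"
  shows "phi_sum (qsh a b) = lser_mult (phi a) (phi b)"
proof (intro ext)
  fix n :: int and j :: nat and m :: monom
  define S where "S = {(p, q). p + q = m}"
  have fin: "finite {j. phi w n j \<noteq> (\<lambda>_. 0)}" if "H_basis w" for w n
    using phi_regularization(1)[OF that] by (simp add: in_GSym_t_laurent_def)
  obtain N M where N: "\<forall>n<N. \<forall>j. phi a n j = (\<lambda>_. 0)" and M: "\<forall>n<M. \<forall>j. phi b n j = (\<lambda>_. 0)"
    using phi_regularization(1)[OF a] phi_regularization(1)[OF b] unfolding in_GSym_t_laurent_def by blast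
  \<comment> \<open>These are the coefficients of \<open>z^n\<close> on the two sides, as
    polynomials in \<open>t\<close>. The range \<open>{N..n - M}\<close> stands in for the support
    used by \<open>lser_mult\<close>.\<close>
  let ?P = "\<lambda>n. \<Sum>w\<leftarrow>qsh a b. t_poly (phi w) n m"
    and ?Q = "\<lambda>n. \<Sum>(p, q)\<in>S. \<Sum>k\<in>{N..n - M}. t_poly (phi a) k p * t_poly (phi b) (n - k) q"
  have "?P n = ?Q n"
  proof (rule poly_eqI_nonneg_reals)
    fix t :: real assume t: "t \<ge> 0"
    have ex: "\<exists>K. half_disc_laurent K (\<lambda>n. \<Sum>w\<leftarrow>qsh a b. poly (t_poly (phi w) n m) (of_real t))
        (\<lambda>z. \<Sum>w\<leftarrow>qsh a b. reg_coeff w m t z)"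
    proof (rule half_disc_laurent_sum_list)
      fix w assume "w \<in> set (qsh a b)"
      hence "H_basis w" using a b H_basis_qsh by blast
      from phi_regularization[OF this] show "\<exists>K. half_disc_laurent K
          (\<lambda>n. poly (t_poly (phi w) n m) (of_real t)) (reg_coeff w m t)"
        using is_regularizationD t unfolding in_GSym_t_laurent_def by blast
    qed
    have "poly (\<Sum>w\<leftarrow>ws. t_poly (phi w) n m) x = (\<Sum>w\<leftarrow>ws. poly (t_poly (phi w) n m) x)" for n x ws
      by (induction ws) simp_all
    then obtain K where "half_disc_laurent K (\<lambda>n. poly (?P n) (of_real t))
        (\<lambda>z. \<Sum>w\<leftarrow>qsh a b. reg_coeff w m t z)" using ex by (simp only:) blast
    moreover have "half_disc_laurent (N + M) (\<lambda>n. poly (?Q n) (of_real t))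
        (\<lambda>z. \<Sum>(p, q)\<in>S. reg_coeff a p t z * reg_coeff b q t z)"
      unfolding case_prod_unfold poly_sum poly_mult
      by (intro half_disc_laurent_sum half_disc_laurent_mult
          is_regularizationD[OF phi_regularization(2)[OF a] N t] is_regularizationD[OF phi_regularization(2)[OF b] M t])
    hence "half_disc_laurent (N + M) (\<lambda>n. poly (?Q n) (of_real t)) (\<lambda>z. \<Sum>w\<leftarrow>qsh a b. reg_coeff w m t z)"
      by (rule half_disc_laurent_cong) (simp add: S_def reg_coeff_mult[OF a b])
    ultimately have "(\<lambda>n. poly (?P n) (of_real t)) = (\<lambda>n. poly (?Q n) (of_real t))"
      by (rule half_disc_laurent_unique)
    thus "poly (?P n) (of_real t) = poly (?Q n) (of_real t)" by meson
  qed
  have "complex_of_rat (phi_sum (qsh a b) n j m) = coeff (?P n) j"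
  proof -
    have "of_rat (\<Sum>w\<leftarrow>ws. phi w n j m) = coeff (\<Sum>w\<leftarrow>ws. t_poly (phi w) n m) j"
      if "\<And>w. w \<in> set ws \<Longrightarrow> H_basis w" for ws
      using that by (induction ws) (simp_all add: of_rat_add coeff_t_poly fin)
    thus ?thesis unfolding phi_sum_def using H_basis_qsh[OF a b] by blast
  qed
  also have "\<dots> = coeff (?Q n) j" by (simp only: \<open>?P n = ?Q n\<close>)
  also have "\<dots> = (\<Sum>pq\<in>S. \<Sum>k\<in>{N..n - M}. \<Sum>i\<le>j. of_rat (phi a k i (fst pq) * phi b (n - k) (j - i) (snd pq)))"
    by (simp add: case_prod_unfold coeff_sum coeff_mult coeff_t_poly fin a b of_rat_mult)
  also have "\<dots> = (\<Sum>k\<in>{N..n - M}. \<Sum>i\<le>j. \<Sum>pq\<in>S. of_rat (phi a k i (fst pq) * phi b (n - k) (j - i) (snd pq)))"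
    by (subst sum.swap, intro sum.cong refl, rule sum.swap)
  also have "\<dots> = of_rat (\<Sum>k\<in>{N..n - M}. \<Sum>i\<le>j. \<Sum>(p, q)\<in>S. phi a k i p * phi b (n - k) (j - i) q)"
    by (simp add: case_prod_unfold of_rat_sum)
  \<comment> \<open>The range contains the support set of \<open>lser_mult\<close>, and each surplus
    term has a vanishing factor.\<close>
  also have "(\<Sum>k\<in>{N..n - M}. \<Sum>i\<le>j. \<Sum>(p, q)\<in>S. phi a k i p * phi b (n - k) (j - i) q) =
      lser_mult (phi a) (phi b) n j m"
    unfolding lser_mult_def S_def
  proof (rule sum.mono_neutral_right)
    show "{k. phi a k \<noteq> (\<lambda>_ _. 0) \<and> phi b (n - k) \<noteq> (\<lambda>_ _. 0)} \<subseteq> {N..n - M}"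
    proof
      fix k assume k: "k \<in> {k. phi a k \<noteq> (\<lambda>_ _. 0) \<and> phi b (n - k) \<noteq> (\<lambda>_ _. 0)}"
      have "\<not> k < N" "\<not> n - k < M" using k N M by auto
      thus "k \<in> {N..n - M}" by auto
    qed
  qed auto
  finally show "phi_sum (qsh a b) n j m = lser_mult (phi a) (phi b) n j m" by simp
qed

theorem theorem3p2:
  shows "(\<forall>w. H_basis w \<longrightarrow>
            (\<forall>m t z. t \<ge> 0 \<and> Re z < 0 \<longrightarrow> ((\<lambda>is. norm (reg_terms w t z is)) summable_on reg_index w m)) \<and>
            (\<exists>!c. in_GSym_t_laurent c \<and> is_regularization w c))
       \<and> phi [] = lser_one
       \<and> (\<forall>a b. H_basis a \<and> H_basis b \<longrightarrow>
            phi_sum (qsh a b) = lser_mult (phi a) (phi b))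
       \<and> (\<forall>w. H_basis w \<and> w \<noteq> [] \<and> fst (last w) > 0 \<longrightarrow> in_GSym_t_power (phi w))"
proof (intro conjI allI impI)
  fix w :: "(nat \<times> nat) list" and m and t :: real and z :: complex
  assume "H_basis w" "t \<ge> 0 \<and> Re z < 0"
  thus "(\<lambda>is. norm (reg_terms w t z is)) summable_on reg_index w m"
    using tail_term_summable[of w z 0 t m] by (simp add: tail_term_0)
next
  fix w :: "(nat \<times> nat) list"
  assume w: "H_basis w \<and> w \<noteq> [] \<and> fst (last w) > 0"
  hence "phi w = tail_ser w 0" by (intro phi_eq_tail_ser) auto
  thus "in_GSym_t_power (phi w)"
    using w tail_ser_in_GSym_t_laurent[of w 0] by (simp add: in_GSym_t_power_def tail_ser_neg)
qed (simp_all add: regularization_exists_unique phi_Nil phi_quasi_shuffle)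

end
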